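(* Let $\gamma\ge 1$, $J>0$, $a>0$ and $0\le K\neq 1$. Rest points of the traveling-wave ODE (equivalently, right states satisfying the Rankine--Hugoniot equations with $s=-1$ and $v_-=1$) correspond to roots $v=v_+\in(0,\infty)\setminus\{K\}$ of $$\tilde f(v):=p(v)-p(1)+J\Big(\frac{(1-K)^2}{(v-K)^2}-1\Big)+v-1,$$ of which there are at most two greater than $K$ and at most two less than $K$. For all parameters $(a,J,K)$ except a set of measure zero, there are exactly two or exactly four roots in total, consisting of an attractor $v_1$ and a saddle $v_2$ ordered as $v_1<v_2<K$, or a saddle $v_3$ and a repellor $v_4$ ordered as $K<v_3<v_4$, or both of these pairs, where the remaining coordinates $(u,w,B)$ of the rest point with $v$-coordinate $v$ are determined by $$u=v-1,\qquad B_-=\frac{v-K}{1-K}\,B,\qquad w=\frac{I}{\mu_0}\,\frac{1-v}{1-K}\,B .$$ Moreover, the relative entropy $\hat\phi$ evaluated at the rest point associated with $v_j$ decreases with $j$.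
   Context: Setting: two-dimensional isentropic magnetohydrodynamics with infinite electrical resistivity ($\sigma=\infty$ in the paper's notation), in rescaled coordinates in which the shock speed is $s=-1$ and the left state is $v_-=1$, $u_-=0$, $w_-=0$, $B_-$. Here $v>0$ is specific volume, $u$ and $w$ the two velocity components, $B$ the transverse magnetic field, $p(v)=av^{-\gamma}$ the pressure, $p_-=p(1)=a$. Constants: $\mu_0>0$, $I\ge 0$, $\mu>0$, $\tau=2\mu+\eta>0$, and $$K=\frac{I^2}{\mu_0},\qquad J=\frac{B_-^2}{2\mu_0}.$$ The case $J>0$ is called nonparallel. Rankine--Hugoniot equations (with $[h]=h_+-h_-$): $-s[v]=[u]$, $-s[u]=-[p+B^2/(2\mu_0)]$, $-s[w]=I[B/\mu_0]$, $-s[vB]=I[w]$, with $s=-1$ and the left state above. The left state itself ($v=1$) is counted among the rest points/solutions. Traveling-wave ODE: viscous profiles satisfy $u=v-1$, $B=(B_-+Iw)/v$, and $(v,w)$ solves the planar system $$\tau v'=v(v-1)+v(p(v)-p_-)+\frac{1}{2\mu_0 v}\big((B_-+Iw)^2-v^2B_-^2\big),\qquad \mu w'=vw-\frac{I}{\mu_0}\big(B_-(1-v)+Iw\big).$$ The terms attractor, saddle, repellor refer to the type of the rest point $(v,w)$ for this planar system. Relative entropy: $$\hat\phi(v,w)=\int_1^v p(z)\,dz-p_-(v-1)+\tfrac12(v-1)^2+\tfrac{w^2}{2}\Big(1-\frac{I^2}{\mu_0 v}\Big)+\frac{B_-Iw}{\mu_0}\Big(1-\frac1v\Big)-\frac{B_-^2}{2\mu_0}\Big(v+\frac1v\Big).$$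 *)

theory Defs
  imports "HOL-Analysis.Analysis"
begin

text \<open>
  The physical parameters: adiabatic exponent, pressure coefficient (the constants \<open>\<gamma>\<close> and
  \<open>a\<close> of \<open>p(v) = a v\<^sup>-\<^sup>\<gamma>\<close>), magnetic permeability \<open>\<mu>\<^sub>0\<close>, longitudinal magnetic
  field \<open>I\<close>, viscosities \<open>\<mu>\<close> and \<open>\<eta>\<close>, and the left transverse field \<open>B\<^sub>-\<close>.
\<close>

record mhd =
  gexp :: real
  pcoef :: real
  mu0 :: real
  Ilong :: real
  visc :: real
  visc2 :: real
  Bleft :: real

definition tau :: "mhd \<Rightarrow> real" where
  "tau P = 2 * visc P + visc2 P"

definition Kpar :: "mhd \<Rightarrow> real" where
  "Kpar P = (Ilong P)\<^sup>2 / mu0 P"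

definition Jpar :: "mhd \<Rightarrow> real" where
  "Jpar P = (Bleft P)\<^sup>2 / (2 * mu0 P)"

definition admissible :: "mhd \<Rightarrow> bool" where
  "admissible P \<longleftrightarrow> gexp P \<ge> 1 \<and> pcoef P > 0 \<and> mu0 P > 0 \<and> Ilong P \<ge> 0 \<and> visc P > 0 \<and> tau P > 0
     \<and> Jpar P > 0 \<and> Kpar P \<noteq> 1"

definition press :: "real \<Rightarrow> real \<Rightarrow> real \<Rightarrow> real" where
  "press g a v = a * v powr (- g)"

abbreviation pressP :: "mhd \<Rightarrow> real \<Rightarrow> real" where
  "pressP P \<equiv> press (gexp P) (pcoef P)"

text \<open>Hugoniot jump conditions for a shock of speed \<open>s\<close>; states are tuples \<open>(v, u, w, B)\<close>.\<close>

fun rankine_hugoniot ::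
  "mhd \<Rightarrow> real \<Rightarrow> real \<times> real \<times> real \<times> real \<Rightarrow> real \<times> real \<times> real \<times> real \<Rightarrow> bool" where
  "rankine_hugoniot P s (vl, ul, wl, Bl) (vr, ur, wr, Br) \<longleftrightarrow>
     - s * (vr - vl) = ur - ul \<and>
     - s * (ur - ul) =
       - ((pressP P vr + Br\<^sup>2 / (2 * mu0 P)) - (pressP P vl + Bl\<^sup>2 / (2 * mu0 P))) \<and>
     - s * (wr - wl) = Ilong P * (Br / mu0 P - Bl / mu0 P) \<and>
     - s * (vr * Br - vl * Bl) = Ilong P * (wr - wl)"

definition right_state :: "mhd \<Rightarrow> real \<Rightarrow> real \<Rightarrow> real \<Rightarrow> real \<Rightarrow> bool" where
  "right_state P v u w B \<longleftrightarrow>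
     v > 0 \<and> rankine_hugoniot P (- 1) (1, 0, 0, Bleft P) (v, u, w, B)"

text \<open>The planar vector field \<open>(v', w')\<close>; the point \<open>x\<close> of the phase plane is \<open>(v, w)\<close>.\<close>

definition tw_field :: "mhd \<Rightarrow> real^2 \<Rightarrow> real^2" where
  "tw_field P x = (let v = x $ 1; w = x $ 2 in vector
     [(v * (v - 1) + v * (pressP P v - pressP P 1)
         + 1 / (2 * mu0 P * v) * ((Bleft P + Ilong P * w)\<^sup>2 - v\<^sup>2 * (Bleft P)\<^sup>2)) / tau P,
      (v * w - Ilong P / mu0 P * (Bleft P * (1 - v) + Ilong P * w)) / visc P])"

definition rest_point :: "mhd \<Rightarrow> real \<Rightarrow> real \<Rightarrow> bool" where
  "rest_point P v w \<longleftrightarrow> v > 0 \<and> tw_field P (vector [v, w]) = 0"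

text \<open>The components \<open>u\<close> and \<open>B\<close> that a viscous profile has at the point \<open>(v, w)\<close>.\<close>

definition profile_coords :: "mhd \<Rightarrow> real \<Rightarrow> real \<Rightarrow> real \<Rightarrow> real \<Rightarrow> bool" where
  "profile_coords P v u w B \<longleftrightarrow> u = v - 1 \<and> B = (Bleft P + Ilong P * w) / v"

text \<open>
  Hyperbolic rest points of a vector field, classified by the (complex) eigenvalues of the
  linearization.
\<close>

definition cx_eigenvalue :: "real^'n^'n \<Rightarrow> complex \<Rightarrow> bool" where
  "cx_eigenvalue A l \<longleftrightarrow> (\<exists>z::complex^'n. z \<noteq> 0 \<and> map_matrix complex_of_real A *v z = l *s z)"

definition attractor :: "(real^'n \<Rightarrow> real^'n) \<Rightarrow> real^'n \<Rightarrow> bool" where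
  "attractor F x \<longleftrightarrow> F x = 0 \<and>
     (\<exists>A. (F has_derivative (\<lambda>h. A *v h)) (at x) \<and> (\<forall>l. cx_eigenvalue A l \<longrightarrow> Re l < 0))"

definition repellor :: "(real^'n \<Rightarrow> real^'n) \<Rightarrow> real^'n \<Rightarrow> bool" where
  "repellor F x \<longleftrightarrow> F x = 0 \<and>
     (\<exists>A. (F has_derivative (\<lambda>h. A *v h)) (at x) \<and> (\<forall>l. cx_eigenvalue A l \<longrightarrow> Re l > 0))"

definition saddle :: "(real^'n \<Rightarrow> real^'n) \<Rightarrow> real^'n \<Rightarrow> bool" where
  "saddle F x \<longleftrightarrow> F x = 0 \<and>
     (\<exists>A. (F has_derivative (\<lambda>h. A *v h)) (at x) \<and>
          (\<forall>l. cx_eigenvalue A l \<longrightarrow> Re l \<noteq> 0) \<and>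
          (\<exists>l. cx_eigenvalue A l \<and> Re l < 0) \<and> (\<exists>l. cx_eigenvalue A l \<and> Re l > 0))"

definition ftilde :: "real \<Rightarrow> real \<Rightarrow> real \<Rightarrow> real \<Rightarrow> real \<Rightarrow> real" where
  "ftilde g a J K v = press g a v - press g a 1 + J * ((1 - K)\<^sup>2 / (v - K)\<^sup>2 - 1) + v - 1"

definition froots :: "real \<Rightarrow> real \<Rightarrow> real \<Rightarrow> real \<Rightarrow> real set" where
  "froots g a J K = {v. v > 0 \<and> v \<noteq> K \<and> ftilde g a J K v = 0}"

definition rest_coords :: "mhd \<Rightarrow> real \<Rightarrow> real \<Rightarrow> real \<Rightarrow> real \<Rightarrow> bool" where
  "rest_coords P v u w B \<longleftrightarrow>
     u = v - 1 \<and>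
     Bleft P = (v - Kpar P) / (1 - Kpar P) * B \<and>
     w = Ilong P / mu0 P * ((1 - v) / (1 - Kpar P)) * B"

text \<open>The interval integral is oriented, so that the case \<open>v < 1\<close> has the usual sign.\<close>

definition rel_entropy :: "mhd \<Rightarrow> real \<Rightarrow> real \<Rightarrow> real" where
  "rel_entropy P v w =
     (LBINT z=1..v. pressP P z) - pressP P 1 * (v - 1) + 1/2 * (v - 1)\<^sup>2
     + w\<^sup>2 / 2 * (1 - (Ilong P)\<^sup>2 / (mu0 P * v))
     + Bleft P * Ilong P * w / mu0 P * (1 - 1 / v)
     - (Bleft P)\<^sup>2 / (2 * mu0 P) * (v + 1 / v)"

end

theory Submission
  imports Defs
begin

text \<open>
  Eliminating \<open>u\<close>, \<open>w\<close> and \<open>B\<close> reduces the Rankine--Hugoniot conditions, and equally the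
  rest point equations, to the scalar equation \<open>ftilde v = 0\<close> on \<open>v > 0\<close>, \<open>v \<noteq> K\<close>
  (\<open>rest_point_iff_right_state\<close>, \<open>right_state_iff_rest_coords\<close>). Everything else follows from
  the graph of \<open>ftilde\<close>.

  On each side of the pole \<open>K\<close> the function is strictly convex, which bounds the number of
  zeros by two (\<open>side_zeros_card_le_2\<close>), and it is positive near both ends. A side therefore
  carries exactly two zeros, with slopes of opposite signs, as soon as \<open>ftilde\<close> is negative
  somewhere on it. The side of \<open>v = 1\<close> has this property unless \<open>1\<close> is a double zero. The
  other side has two zeros or none unless the graph just touches the axis. For given
  \<open>(J, K)\<close> each exception singles out at most one \<open>a\<close>: \<open>ftilde'(1)\<close> is affine in \<open>a\<close>,
  and on the side without \<open>1\<close> the minimum of \<open>ftilde\<close> is strictly monotone in \<open>a\<close>, since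
  \<open>v\<^sup>-\<^sup>\<gamma> - 1\<close> has a fixed sign there. Fubini shows that the exceptional
  parameters form a null set (\<open>AE_nondegenerate\<close>).

  The planar system is of gradient type, \<open>\<tau> v' = v \<phi>\<^sub>v\<close> and \<open>\<mu> w' = v \<phi>\<^sub>w\<close> with the relative
  entropy \<open>\<phi>\<close>. Its linearization at a rest point has real eigenvalues, determinant
  \<open>v (v - K) ftilde'(v) / (\<tau> \<mu>)\<close> and second diagonal entry \<open>(v - K) / \<mu>\<close>
  (\<open>det_rest_jacobian\<close>), so that the side of \<open>K\<close> and the slope of \<open>ftilde\<close> determine
  the type (\<open>rest_point_type\<close>).

  Along the curve \<open>\<phi>\<^sub>w = 0\<close>, which contains all rest points, the derivative of \<open>\<phi>\<close> with respect
  to \<open>v\<close> is \<open>ftilde\<close>. Between two zeros on the same side this is negative. Across the pole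
  the regular and the singular part of \<open>\<phi>\<close> decrease separately
  (\<open>rest_entropy_less_across\<close>). Hence \<open>\<phi>\<close> decreases from any zero to any larger one.
\<close>

section \<open>Rest points and the Rankine--Hugoniot relations\<close>

lemma admissible_pos:
  assumes "admissible P"
  shows "mu0 P > 0" "visc P > 0" "tau P > 0" "Kpar P \<noteq> 1" "Bleft P \<noteq> 0" "Kpar P \<ge> 0"
    "Jpar P > 0" "pcoef P > 0" "gexp P \<ge> 1"
  using assms by (auto simp: admissible_def Jpar_def Kpar_def)

lemma tw_field_component [simp]:
  "tw_field P x $ 1 = (x $ 1 * (x $ 1 - 1) + x $ 1 * (pressP P (x $ 1) - pressP P 1)
     + 1 / (2 * mu0 P * x $ 1) * ((Bleft P + Ilong P * x $ 2)\<^sup>2 - (x $ 1)\<^sup>2 * (Bleft P)\<^sup>2)) / tau P"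
  "tw_field P x $ 2 = (x $ 1 * x $ 2
     - Ilong P / mu0 P * (Bleft P * (1 - x $ 1) + Ilong P * x $ 2)) / visc P"
  by (simp_all add: tw_field_def Let_def)

text \<open>
  The common factor \<open>v\<close> of the first component is divided out. What remains is the momentum
  jump condition, with \<open>B\<close> already expressed through \<open>(B\<^sub>- + I w) / v\<close>.
\<close>

lemma rest_point_iff:
  assumes "admissible P"
  shows "rest_point P v w \<longleftrightarrow> v > 0 \<and>
     (v - 1) + (pressP P v - pressP P 1)
       + (((Bleft P + Ilong P * w) / v)\<^sup>2 - (Bleft P)\<^sup>2) / (2 * mu0 P) = 0 \<and>
     w * v = Ilong P / mu0 P * (Bleft P * (1 - v) + Ilong P * w)"
proof (cases "v > 0")
  case True
  note pos = admissible_pos[OF assms]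
  have factor: "v * (v - 1) + v * (pressP P v - pressP P 1)
     + 1 / (2 * mu0 P * v) * ((Bleft P + Ilong P * w)\<^sup>2 - v\<^sup>2 * (Bleft P)\<^sup>2)
     = v * ((v - 1) + (pressP P v - pressP P 1)
       + (((Bleft P + Ilong P * w) / v)\<^sup>2 - (Bleft P)\<^sup>2) / (2 * mu0 P))"
    using True pos by (simp add: field_simps power2_eq_square)
  show ?thesis
    using True pos factor
    by (auto simp: rest_point_def vec_eq_iff forall_2 mult.commute)
qed (simp add: rest_point_def)

lemma right_state_iff:
  "right_state P v u w B \<longleftrightarrow> v > 0 \<and> u = v - 1 \<and>
     (v - 1) + (pressP P v - pressP P 1) + (B\<^sup>2 - (Bleft P)\<^sup>2) / (2 * mu0 P) = 0 \<and>
     w = Ilong P / mu0 P * (B - Bleft P) \<and> v * B - Bleft P = Ilong P * w"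
  by (auto simp: right_state_def diff_divide_distrib right_diff_distrib)

lemma rest_point_iff_right_state:
  assumes "admissible P"
  shows "rest_point P v w \<and> profile_coords P v u w B \<longleftrightarrow> right_state P v u w B"
proof (cases "v > 0")
  case True
  note pos = admissible_pos[OF assms]
  have B: "B = (Bleft P + Ilong P * w) / v \<longleftrightarrow> v * B - Bleft P = Ilong P * w"
    using True by (auto simp: field_simps)
  have "w * v = Ilong P / mu0 P * (Bleft P * (1 - v) + Ilong P * w) \<longleftrightarrow>
        w = Ilong P / mu0 P * (B - Bleft P)"
    if "v * B - Bleft P = Ilong P * w"
  proof -
    have "Bleft P * (1 - v) + Ilong P * w = v * (B - Bleft P)"
      unfolding that[symmetric] by (simp add: algebra_simps)
    then have "Ilong P / mu0 P * (Bleft P * (1 - v) + Ilong P * w)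
        = Ilong P / mu0 P * (B - Bleft P) * v" by simp
    then show ?thesis using True by (metis mult_cancel_right less_irrefl)
  qed
  then show ?thesis
    unfolding rest_point_iff[OF assms] right_state_iff profile_coords_def
    using B True by auto
qed (simp add: rest_point_def right_state_def)

lemma Bleft_sq:
  assumes "admissible P" shows "(Bleft P)\<^sup>2 = 2 * mu0 P * Jpar P"
  using admissible_pos[OF assms] by (simp add: Jpar_def)

lemma Ilong_sq:
  assumes "admissible P" shows "(Ilong P)\<^sup>2 = mu0 P * Kpar P"
  using admissible_pos[OF assms] by (simp add: Kpar_def)

lemma rest_coords_iff:
  assumes "admissible P" "v \<noteq> Kpar P"
  shows "rest_coords P v u w B \<longleftrightarrow> u = v - 1 \<and> B = (1 - Kpar P) / (v - Kpar P) * Bleft P \<and>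
     w = Ilong P / mu0 P * ((1 - v) / (v - Kpar P)) * Bleft P"
proof -
  have nz: "1 - Kpar P \<noteq> 0" "v - Kpar P \<noteq> 0"
    using assms admissible_pos by auto
  have B: "Bleft P = (v - Kpar P) / (1 - Kpar P) * B \<longleftrightarrow>
      B = (1 - Kpar P) / (v - Kpar P) * Bleft P"
    using nz by (simp add: eq_divide_eq divide_eq_eq) (auto simp: mult.commute)
  have "(1 - v) / (1 - Kpar P) * ((1 - Kpar P) / (v - Kpar P) * Bleft P)
      = (1 - v) / (v - Kpar P) * Bleft P"
    using nz by simp
  then show ?thesis
    unfolding rest_coords_def B by (auto simp: mult.assoc)
qed

text \<open>
  Elimination of \<open>u\<close>, \<open>w\<close> and \<open>B\<close> in favour of \<open>v\<close>: the two magnetic conditions give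
  \<open>B\<^sup>2 - B\<^sub>-\<^sup>2 = B\<^sub>-\<^sup>2 ((1 - K)\<^sup>2 / (v - K)\<^sup>2 - 1)\<close>, which turns the momentum condition into
  \<open>ftilde = 0\<close> because \<open>B\<^sub>-\<^sup>2 = 2 \<mu>\<^sub>0 J\<close>.
\<close>

lemma right_state_iff_rest_coords:
  assumes adm: "admissible P"
  shows "right_state P v u w B \<longleftrightarrow>
    v \<in> froots (gexp P) (pcoef P) (Jpar P) (Kpar P) \<and> rest_coords P v u w B"
proof -
  note pos = admissible_pos[OF adm]
  define K where "K = Kpar P"
  have K: "1 - K \<noteq> 0" using pos by (simp add: K_def)
  have I: "Ilong P * (Ilong P / mu0 P * x) = K * x" for x
    by (simp add: K_def Kpar_def power2_eq_square)
  \<comment> \<open>Eliminating \<open>w\<close> from the last two jump conditions leaves the relation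
      \<open>(v - K) B = (1 - K) B\<^sub>-\<close>, which is unsolvable at \<open>v = K\<close> because \<open>B\<^sub>- \<noteq> 0\<close>.\<close>
  have wB: "w = Ilong P / mu0 P * (B - Bleft P) \<and> v * B - Bleft P = Ilong P * w \<longleftrightarrow>
      v \<noteq> K \<and> Bleft P = (v - K) / (1 - K) * B \<and>
      w = Ilong P / mu0 P * ((1 - v) / (1 - K)) * B" (is "?L \<longleftrightarrow> ?R")
  proof
    assume L: ?L
    then have "v * B - Bleft P = K * (B - Bleft P)" using I by metis
    then have eq: "(v - K) * B = (1 - K) * Bleft P" by (simp add: algebra_simps)
    then have 1: "Bleft P = (v - K) / (1 - K) * B" using K by (simp add: field_simps)
    have 2: "v \<noteq> K" using eq K pos(5) by auto
    have "B - Bleft P = ((1 - v) / (1 - K)) * B"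
      using K by (subst 1) (simp add: field_simps)
    then show ?R using 1 2 L by simp
  next
    assume R: ?R
    then have 1: "Bleft P = (v - K) / (1 - K) * B" by simp
    then have "(v - K) * B = (1 - K) * Bleft P" using K by (simp add: field_simps)
    then have eq: "v * B - Bleft P = K * (B - Bleft P)" by (simp add: algebra_simps)
    have "B - Bleft P = ((1 - v) / (1 - K)) * B"
      using K by (subst 1) (simp add: field_simps)
    then have w: "w = Ilong P / mu0 P * (B - Bleft P)" using R by simp
    show ?L using w eq I by metis
  qed
  have Bsq: "(B\<^sup>2 - (Bleft P)\<^sup>2) / (2 * mu0 P) = Jpar P * ((1 - K)\<^sup>2 / (v - K)\<^sup>2 - 1)"
    if "v \<noteq> K" "Bleft P = (v - K) / (1 - K) * B"
  proof -
    have "B = (1 - K) / (v - K) * Bleft P" using that K by (simp add: field_simps)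
    then have "B\<^sup>2 = (1 - K)\<^sup>2 / (v - K)\<^sup>2 * (Bleft P)\<^sup>2"
      by (simp add: power_mult_distrib power_divide)
    then have "B\<^sup>2 - (Bleft P)\<^sup>2 = (2 * mu0 P) * (Jpar P * ((1 - K)\<^sup>2 / (v - K)\<^sup>2 - 1))"
      unfolding Bleft_sq[OF adm] by (simp add: algebra_simps)
    then show ?thesis using pos by simp
  qed
  show ?thesis
    unfolding right_state_iff froots_def rest_coords_def ftilde_def K_def[symmetric] mem_Collect_eq
    using wB Bsq by (auto simp: algebra_simps)
qed

lemma unique_rest_coords:
  assumes "admissible P" "v \<noteq> Kpar P"
  shows "\<exists>!(u, w, B). rest_coords P v u w B"
proof -
  have "\<exists>!x. x = (u, w, B)" for u w B :: real by simp
  then show ?thesis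
    unfolding rest_coords_iff[OF assms]
    by (auto simp: case_prod_beta prod_eq_iff intro!: ex1I[of _ "(_, _, _)"])
qed

section \<open>Convexity on the two sides of the pole\<close>

lemma press_has_derivative:
  assumes "v > 0"
  shows "(press g a has_real_derivative - (a * g * v powr (- g - 1))) (at v)"
  unfolding press_def
  by (rule DERIV_cong[OF DERIV_cmult[OF has_real_derivative_powr[OF assms]]]) simp

definition ftilde_deriv :: "real \<Rightarrow> real \<Rightarrow> real \<Rightarrow> real \<Rightarrow> real \<Rightarrow> real" where
  "ftilde_deriv g a J K v = 1 - a * g * v powr (- g - 1) - 2 * J * (1 - K)\<^sup>2 / (v - K) ^ 3"

lemma ftilde_has_derivative:
  assumes "v > 0" "v \<noteq> K"
  shows "(ftilde g a J K has_real_derivative ftilde_deriv g a J K v) (at v)"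
proof -
  have vK: "(v - K)\<^sup>2 \<noteq> 0" "v - K \<noteq> 0" using assms by auto
  have pole: "((\<lambda>v. (1 - K)\<^sup>2 / (v - K)\<^sup>2) has_real_derivative - 2 * (1 - K)\<^sup>2 / (v - K) ^ 3) (at v)"
    by (rule derivative_eq_intros refl vK)+
      (use vK in \<open>simp add: divide_simps power2_eq_square power3_eq_cube\<close>)
  have "ftilde g a J K = (\<lambda>v. press g a v - press g a 1 + J * ((1 - K)\<^sup>2 / (v - K)\<^sup>2 - 1) + v - 1)"
    by (simp add: ftilde_def fun_eq_iff)
  moreover have "(\<dots> has_real_derivative
      - (a * g * v powr (- g - 1)) - 0 + J * (- 2 * (1 - K)\<^sup>2 / (v - K) ^ 3 - 0) + 1 - 0) (at v)"
    by (intro DERIV_diff DERIV_add DERIV_const DERIV_ident DERIV_cmult press_has_derivative pole assms)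
  ultimately show ?thesis
    by (simp add: ftilde_deriv_def algebra_simps)
qed

lemma ftilde_one [simp]: "K \<noteq> 1 \<Longrightarrow> ftilde g a J K 1 = 0"
  by (simp add: ftilde_def)

text \<open>
  The two intervals into which the pole \<open>K\<close> cuts the half-line \<open>v > 0\<close>; the left one is
  empty when \<open>K = 0\<close>.
\<close>

definition sides :: "real \<Rightarrow> real set set" where
  "sides K = {{0<..<K}, {K<..}}"

lemma sidesD:
  assumes "S \<in> sides K" "K \<ge> 0" "v \<in> S"
  shows "v > 0" "v \<noteq> K"
  using assms by (auto simp: sides_def)

lemma sides_is_interval:
  assumes "S \<in> sides K"
  shows "is_interval S"
  using assms by (auto simp: sides_def is_interval_1)

text \<open>
  The magnetic term \<open>J (1 - K)\<^sup>2 / (v - K)\<^sup>2\<close> is convex on either side of the pole, and the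
  pressure is strictly convex.
\<close>

lemma ftilde_deriv_strict_mono:
  assumes "g \<ge> 1" "a > 0" "J > 0" "K \<ge> 0" "S \<in> sides K"
  shows "strict_mono_on S (ftilde_deriv g a J K)"
proof (rule strict_mono_onI)
  fix x y assume xy: "x \<in> S" "y \<in> S" "x < y"
  have x: "x > 0" using sidesD assms xy by blast
  have "y powr (- g - 1) < x powr (- g - 1)"
    using xy x assms by (intro powr_less_mono2_neg) auto
  then have "a * g * y powr (- g - 1) < a * g * x powr (- g - 1)"
    using assms by simp
  moreover have "2 * J * (1 - K)\<^sup>2 / (y - K) ^ 3 \<le> 2 * J * (1 - K)\<^sup>2 / (x - K) ^ 3"
  proof (rule divide_left_mono)
    show "(x - K) ^ 3 \<le> (y - K) ^ 3" using xy by (intro power_mono_odd) auto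
    have "0 < (x - K) * (y - K)"
      using xy assms by (auto simp: sides_def zero_less_mult_iff)
    then show "0 < (y - K) ^ 3 * (x - K) ^ 3"
      by (simp add: power_mult_distrib[symmetric] mult.commute)
  qed (use assms in auto)
  ultimately show "ftilde_deriv g a J K x < ftilde_deriv g a J K y"
    by (simp add: ftilde_deriv_def)
qed

text \<open>
  The picture of a strictly convex function that vanishes twice. The chord slopes lie strictly
  between the slopes at the end points, so between two zeros the graph lies below the axis,
  and outside them above it.
\<close>

lemma two_zeros_increasing_derivative:
  fixes f f' :: "real \<Rightarrow> real"
  assumes S: "is_interval S"
    and f': "\<And>v. v \<in> S \<Longrightarrow> (f has_real_derivative f' v) (at v)"
    and mono: "strict_mono_on S f'"
    and xy: "x \<in> S" "y \<in> S" "x < y" "f x = 0" "f y = 0"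
  shows "f' x < 0" and "f' y > 0"
    and "\<And>z. x < z \<Longrightarrow> z < y \<Longrightarrow> f z < 0"
    and "{v \<in> S. f v = 0} = {x, y}"
proof -
  have mvt: "\<exists>t>u. t < v \<and> t \<in> S \<and> f v - f u = (v - u) * f' t"
    if "u \<in> S" "v \<in> S" "u < v" for u v
    using MVT2[of u v f f'] that f' mem_is_interval_1_I[OF S] by (meson less_imp_le)
  have slope: "f' u * (v - u) < f v - f u" "f v - f u < f' v * (v - u)"
    if uv: "u \<in> S" "v \<in> S" "u < v" for u v
  proof -
    obtain t where t: "t > u" "t < v" "t \<in> S" "f v - f u = (v - u) * f' t"
      using mvt[OF uv] by blast
    then have "f' u < f' t" "f' t < f' v"
      using mono uv by (auto dest: strict_mono_onD)
    then show "f' u * (v - u) < f v - f u" "f v - f u < f' v * (v - u)"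
      using t uv by (simp_all add: mult.commute)
  qed
  show x': "f' x < 0" and y': "f' y > 0"
    using slope[of x y] xy by (auto simp: mult_less_0_iff zero_less_mult_iff)
  show neg: "f z < 0" if z: "x < z" "z < y" for z
  proof (rule ccontr)
    assume "\<not> f z < 0"
    moreover have zS: "z \<in> S" using z xy mem_is_interval_1_I[OF S, of x y z] by auto
    ultimately have "0 < f' z * (z - x)" "f' z * (y - z) < 0"
      using slope[of x z] slope[of z y] z xy by auto
    then show False using z by (auto simp: mult_less_0_iff zero_less_mult_iff)
  qed
  have "f z \<noteq> 0" if z: "z \<in> S" "z \<noteq> x" "z \<noteq> y" for z
  proof -
    consider "z < x" | "x < z" "z < y" | "y < z" using z by (metis linorder_neqE)
    then show ?thesis
    proof cases
      case 1
      have "f' x * (x - z) < 0" using 1 x' by (simp add: mult_less_0_iff)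
      then show ?thesis using slope(2)[of z x] z xy 1 by auto
    next
      case 2
      then show ?thesis using neg by force
    next
      case 3
      have "f' y * (z - y) > 0" using 3 y' by simp
      then show ?thesis using slope(1)[of y z] z xy 3 by auto
    qed
  qed
  then show "{v \<in> S. f v = 0} = {x, y}" using xy by blast
qed

lemma ftilde_two_zeros:
  assumes "g \<ge> 1" "a > 0" "J > 0" "K \<ge> 0" "S \<in> sides K"
    and "x \<in> S" "y \<in> S" "x < y" "ftilde g a J K x = 0" "ftilde g a J K y = 0"
  shows "ftilde_deriv g a J K x < 0" and "ftilde_deriv g a J K y > 0"
    and "\<And>z. x < z \<Longrightarrow> z < y \<Longrightarrow> ftilde g a J K z < 0"
    and "{v \<in> S. ftilde g a J K v = 0} = {x, y}"
proof -
  have d: "(ftilde g a J K has_real_derivative ftilde_deriv g a J K v) (at v)" if "v \<in> S" for v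
    using that assms sidesD by (intro ftilde_has_derivative) blast+
  note * = two_zeros_increasing_derivative[of S "ftilde g a J K",
      OF sides_is_interval[OF assms(5)] d ftilde_deriv_strict_mono[OF assms(1-5)] assms(6-10)]
  show "ftilde_deriv g a J K x < 0" "ftilde_deriv g a J K y > 0"
    "{v \<in> S. ftilde g a J K v = 0} = {x, y}"
    by (rule *; assumption)+
  show "ftilde g a J K z < 0" if "x < z" "z < y" for z
    using that by (intro *(3))
qed

lemma froots_side:
  assumes "K \<ge> 0"
  shows "{v \<in> froots g a J K. v < K} = {v \<in> {0<..<K}. ftilde g a J K v = 0}"
    and "{v \<in> froots g a J K. v > K} = {v \<in> {K<..}. ftilde g a J K v = 0}"
  using assms by (auto simp: froots_def)

lemma side_zeros_card_le_2:
  assumes "g \<ge> 1" "a > 0" "J > 0" "K \<ge> 0" "S \<in> sides K"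
  shows "finite {v \<in> S. ftilde g a J K v = 0} \<and> card {v \<in> S. ftilde g a J K v = 0} \<le> 2"
    (is "finite ?Z \<and> _")
proof (cases "\<exists>x y. x \<in> ?Z \<and> y \<in> ?Z \<and> x < y")
  case True
  then obtain x y where xy: "x \<in> ?Z" "y \<in> ?Z" "x < y" by blast
  then have "?Z = {x, y}" using ftilde_two_zeros(4)[OF assms, of x y] by simp
  then show ?thesis using xy by simp
next
  case False
  then have "?Z = {} \<or> (\<exists>x. ?Z = {x})" by (metis (no_types, lifting) antisym_conv3 is_singletonI' is_singleton_the_elem)
  moreover have "finite Z \<and> card Z \<le> 2" if "Z = {} \<or> (\<exists>x. Z = {x})" for Z :: "real set"
    using that by auto
  ultimately show ?thesis by blast
qed

lemma zero_in_between:
  assumes "K \<ge> 0" "S \<in> sides K" "x \<in> S" "y \<in> S" "x < y" 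
    and "ftilde g a J K x * ftilde g a J K y < 0"
  obtains z where "x < z" "z < y" "ftilde g a J K z = 0"
proof -
  have "isCont (ftilde g a J K) z" if "x \<le> z" "z \<le> y" for z
    using sidesD[OF assms(2,1)] mem_is_interval_1_I[OF sides_is_interval[OF assms(2)] assms(3,4) that]
    by (intro DERIV_isCont[OF ftilde_has_derivative]) auto
  then have c: "continuous_on {x..y} (ftilde g a J K)"
    by (auto intro: continuous_at_imp_continuous_on)
  consider "ftilde g a J K x < 0" "0 < ftilde g a J K y" | "ftilde g a J K y < 0" "0 < ftilde g a J K x"
    using assms(6) by (auto simp: mult_less_0_iff)
  then obtain z where z: "x \<le> z" "z \<le> y" "ftilde g a J K z = 0"
    using IVT'[OF _ _ _ c, of 0] IVT2'[OF _ _ _ c, of 0] assms(5) by (metis less_imp_le)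
  then have "z \<noteq> x" "z \<noteq> y" using assms(6) by auto
  then show ?thesis using z that[of z] by simp
qed

section \<open>Growth at the ends\<close>

lemma press_one [simp]: "press g a 1 = a"
  by (simp add: press_def)

lemma ftilde_expand:
  "ftilde g a J K v = press g a v + J * ((1 - K)\<^sup>2 / (v - K)\<^sup>2) - a - J + v - 1"
  by (simp add: ftilde_def algebra_simps)

text \<open>
  The distance \<open>d\<close> from the pole can be prescribed independently of the side on which
  \<open>v\<close> lies, so the lemma serves the right end of the left interval and the left end of the
  right one.
\<close>

lemma ftilde_pos_near_pole:
  assumes "a > 0" "J > 0" "K \<noteq> 1" "\<delta> > 0"
  obtains d where "0 < d" "d < \<delta>"
    "\<And>v. v > 0 \<Longrightarrow> \<bar>v - K\<bar> = d \<Longrightarrow> ftilde g a J K v > 0"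
proof
  \<comment> \<open>The magnetic term exceeds \<open>a + J + 1\<close> as soon as \<open>(v - K)\<^sup>2 < c\<close>; the rest of
      \<open>ftilde\<close> is at least \<open>- (a + J + 1)\<close> because \<open>p\<close> and \<open>v\<close> are positive.\<close>
  define c where "c = J * (1 - K)\<^sup>2 / (a + J + 1)"
  have c: "c > 0" using assms by (simp add: c_def)
  define d where "d = min (\<delta> / 2) (sqrt c / 2)"
  show d: "0 < d" "d < \<delta>" using c assms by (auto simp: d_def)
  show "ftilde g a J K v > 0" if v: "v > 0" "\<bar>v - K\<bar> = d" for v
  proof -
    have "d \<le> sqrt c / 2" "sqrt c > 0" using c by (simp_all add: d_def)
    then have "d < sqrt c" by linarith
    then have "d\<^sup>2 < c" using d real_less_rsqrt c
      by (metis abs_of_pos power2_eq_square real_sqrt_abs real_sqrt_less_iff)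
    then have "(v - K)\<^sup>2 < c" using v(2) by (metis power2_abs)
    moreover have vK: "(v - K)\<^sup>2 > 0" using v d by auto
    ultimately have "a + J + 1 < J * (1 - K)\<^sup>2 / (v - K)\<^sup>2"
      using assms by (simp add: c_def field_simps)
    moreover have "press g a v \<ge> 0" using assms by (simp add: press_def)
    ultimately show ?thesis using v unfolding ftilde_expand times_divide_eq_right by linarith
  qed
qed

lemma ftilde_pos_large:
  assumes "a > 0" "J > 0" "v > a + J + 1"
  shows "ftilde g a J K v > 0"
proof -
  have "press g a v \<ge> 0" "J * ((1 - K)\<^sup>2 / (v - K)\<^sup>2) \<ge> 0" using assms by (simp_all add: press_def)
  then show ?thesis using assms unfolding ftilde_expand by linarith
qed

text \<open>
  This is where \<open>\<gamma> \<ge> 1\<close> gives an explicit bound: \<open>p(v) \<ge> a / v\<close> for \<open>v \<le> 1\<close>.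
\<close>

lemma ftilde_pos_near_zero:
  assumes "g \<ge> 1" "a > 0" "J > 0" "0 < v" "v < a / (a + J + 1)"
  shows "ftilde g a J K v > 0"
proof -
  have "a / (a + J + 1) \<le> 1" using assms by simp
  then have "v < 1" using assms by linarith
  have "a + J + 1 < a / v" using assms by (simp add: field_simps)
  also have "a / v = a * v powr (- 1)" using assms by (simp add: powr_minus_divide)
  also have "\<dots> \<le> press g a v"
    using assms \<open>v < 1\<close> unfolding press_def by (intro mult_left_mono powr_mono') auto
  finally have "a + J + 1 < press g a v" .
  moreover have "J * ((1 - K)\<^sup>2 / (v - K)\<^sup>2) \<ge> 0" using assms by simp
  ultimately show ?thesis using assms unfolding ftilde_expand by linarith
qed

lemma side_positive_ends:
  assumes "g \<ge> 1" "a > 0" "J > 0" "K \<ge> 0" "K \<noteq> 1" "S \<in> sides K" "q \<in> S"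
  obtains l r where "l \<in> S" "r \<in> S" "l < q" "q < r" "ftilde g a J K l > 0" "ftilde g a J K r > 0"
proof (cases "S = {K<..}")
  case True
  have qK: "q - K > 0" using assms True by simp
  from ftilde_pos_near_pole[OF assms(2,3,5) qK, where g=g] obtain d where d: "0 < d" "d < q - K"
    "\<And>v. v > 0 \<Longrightarrow> \<bar>v - K\<bar> = d \<Longrightarrow> ftilde g a J K v > 0" by metis
  have "ftilde g a J K (max q (a + J + 1) + 1) > 0"
    by (rule ftilde_pos_large) (use assms in auto)
  moreover have "ftilde g a J K (K + d) > 0" by (rule d(3)) (use d assms in auto)
  ultimately show ?thesis
    using that[of "K + d" "max q (a + J + 1) + 1"] d True qK by auto
next
  case False
  then have S: "S = {0<..<K}" using assms by (auto simp: sides_def)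
  have qK: "K - q > 0" using assms S by simp
  from ftilde_pos_near_pole[OF assms(2,3,5) qK, where g=g] obtain d where d: "0 < d" "d < K - q"
    "\<And>v. v > 0 \<Longrightarrow> \<bar>v - K\<bar> = d \<Longrightarrow> ftilde g a J K v > 0" by metis
  define l where "l = min (q / 2) (a / (2 * (a + J + 1)))"
  have q: "q > 0" using assms S by simp
  have b: "a / (2 * (a + J + 1)) < a / (a + J + 1)" "a / (2 * (a + J + 1)) > 0"
    using assms by (simp_all add: divide_strict_left_mono)
  have l': "l \<le> q / 2" "l \<le> a / (2 * (a + J + 1))" "l > 0"
    unfolding l_def using q b
    by (simp_all only: min.cobounded1 min.cobounded2 min_less_iff_conj half_gt_zero_iff)
  have l: "0 < l" "l < q" "l < a / (a + J + 1)"
    using l' q le_less_trans[OF l'(2) b(1)] by auto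
  have "ftilde g a J K l > 0"
    by (rule ftilde_pos_near_zero) (use assms l in auto)
  moreover have "ftilde g a J K (K - d) > 0" by (rule d(3)) (use d q in auto)
  ultimately show ?thesis
    using that[of l "K - d"] d S q l by auto
qed

text \<open>
  \<open>ftilde\<close> is positive near both ends of a side, so a single negative value forces a zero
  to its left and another to its right.
\<close>

lemma side_zeros_of_negative_value:
  assumes "g \<ge> 1" "a > 0" "J > 0" "K \<ge> 0" "K \<noteq> 1" "S \<in> sides K" "q \<in> S"
    and neg: "ftilde g a J K q < 0"
  obtains x y where "x \<in> S" "y \<in> S" "x < y" "{v \<in> S. ftilde g a J K v = 0} = {x, y}"
proof -
  obtain l r where lr: "l \<in> S" "r \<in> S" "l < q" "q < r"
    "ftilde g a J K l > 0" "ftilde g a J K r > 0"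
    using side_positive_ends[OF assms(1-7)] by blast
  obtain x where x: "l < x" "x < q" "ftilde g a J K x = 0"
    using zero_in_between[OF assms(4,6) lr(1) assms(7) lr(3), of g a J] neg lr
    by (auto simp: mult_less_0_iff)
  obtain y where y: "q < y" "y < r" "ftilde g a J K y = 0"
    using zero_in_between[OF assms(4,6,7) lr(2,4), of g a J] neg lr
    by (auto simp: mult_less_0_iff)
  have S: "x \<in> S" "y \<in> S"
    using mem_is_interval_1_I[OF sides_is_interval[OF assms(6)] lr(1,2)] x y by auto
  moreover have "{v \<in> S. ftilde g a J K v = 0} = {x, y}"
    by (rule ftilde_two_zeros) (use assms S x y in auto)
  ultimately show ?thesis using that[of x y] x y by auto
qed

section \<open>Generic parameters\<close>

text \<open>
  The left state \<open>v = 1\<close> is always a root. The sides are therefore distinguished by whether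
  they contain it: on the near side degeneracy can only happen at \<open>v = 1\<close> itself, while on the
  far side the whole graph has to be considered.
\<close>

definition far_side :: "real \<Rightarrow> real set" where
  "far_side K = (if K < 1 then {0<..<K} else {K<..})"

definition near_side :: "real \<Rightarrow> real set" where
  "near_side K = (if K < 1 then {K<..} else {0<..<K})"

lemma far_near_side:
  assumes "K \<ge> 0" "K \<noteq> 1"
  shows "far_side K \<in> sides K" "near_side K \<in> sides K" "1 \<in> near_side K"
  using assms by (auto simp: sides_def far_side_def near_side_def)

text \<open>
  This says that the infimum of \<open>ftilde\<close> over the far side is \<open>0\<close>, that is, the graph touches
  the axis there without crossing it. Continuity allows the infimum to be taken over rational
  points, and then the set of parameters is visibly a Borel set.
\<close>

definition touching :: "real \<Rightarrow> real \<Rightarrow> real \<Rightarrow> real \<Rightarrow> bool" where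
  "touching g a J K \<longleftrightarrow>
     (\<forall>q::rat. of_rat q \<in> far_side K \<longrightarrow> ftilde g a J K (of_rat q) \<ge> 0) \<and>
     (\<forall>n::nat. \<exists>q::rat. of_rat q \<in> far_side K \<and> ftilde g a J K (of_rat q) < 1 / Suc n)"

text \<open>
  The first condition makes \<open>v = 1\<close> a simple root, the second excludes a double root on the
  far side.
\<close>

definition nondegenerate :: "real \<Rightarrow> real \<Rightarrow> real \<Rightarrow> real \<Rightarrow> bool" where
  "nondegenerate g a J K \<longleftrightarrow> ftilde_deriv g a J K 1 \<noteq> 0 \<and> \<not> touching g a J K"

text \<open>
  \<open>ftilde\<close> crosses the axis transversally at \<open>v = 1\<close>, so it is negative close to \<open>1\<close> on
  one of its two sides.
\<close>

lemma near_side_two_zeros: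
  assumes "g \<ge> 1" "a > 0" "J > 0" "K \<ge> 0" "K \<noteq> 1" "ftilde_deriv g a J K 1 \<noteq> 0"
  obtains x y where "x \<in> near_side K" "y \<in> near_side K" "x < y"
    "{v \<in> near_side K. ftilde g a J K v = 0} = {x, y}"
proof -
  note side = far_near_side[OF assms(4,5)]
  have "open (near_side K)" by (auto simp: near_side_def)
  then obtain e where e: "e > 0" "\<And>v. \<bar>v - 1\<bar> < e \<Longrightarrow> v \<in> near_side K"
    using side(3) by (auto simp: open_dist dist_real_def)
  have D: "(ftilde g a J K has_real_derivative ftilde_deriv g a J K 1) (at 1)"
    using assms by (intro ftilde_has_derivative) auto
  have "\<exists>q\<in>near_side K. ftilde g a J K q < 0"
  proof (cases "ftilde_deriv g a J K 1 > 0")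
    case True
    from DERIV_pos_inc_left[OF D True] obtain d where d: "d > 0"
      "\<And>h. 0 < h \<Longrightarrow> h < d \<Longrightarrow> ftilde g a J K (1 - h) < ftilde g a J K 1" by blast
    define h where "h = min d e / 2"
    have "0 < h" "h < d" "h < e" using d e by (auto simp: h_def)
    then have "ftilde g a J K (1 - h) < 0" "1 - h \<in> near_side K" using d e assms by auto
    then show ?thesis by blast
  next
    case False
    then have "ftilde_deriv g a J K 1 < 0" using assms by simp
    from DERIV_neg_dec_right[OF D this] obtain d where d: "d > 0"
      "\<And>h. 0 < h \<Longrightarrow> h < d \<Longrightarrow> ftilde g a J K (1 + h) < ftilde g a J K 1" by blast
    define h where "h = min d e / 2"
    have "0 < h" "h < d" "h < e" using d e by (auto simp: h_def)
    then have "ftilde g a J K (1 + h) < 0" "1 + h \<in> near_side K" using d e assms by auto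
    then show ?thesis by blast
  qed
  then show ?thesis
    using side_zeros_of_negative_value[OF assms(1-5) side(2)] that by blast
qed

text \<open>
  If there is no negative value, then the values at rational points are bounded below by some
  \<open>1 / (n + 1)\<close>, and by continuity this excludes zeros altogether.
\<close>

lemma far_side_zeros:
  assumes "g \<ge> 1" "a > 0" "J > 0" "K \<ge> 0" "K \<noteq> 1" "\<not> touching g a J K"
  shows "{v \<in> far_side K. ftilde g a J K v = 0} = {} \<or>
    (\<exists>x y. x \<in> far_side K \<and> y \<in> far_side K \<and> x < y \<and>
       {v \<in> far_side K. ftilde g a J K v = 0} = {x, y})"
proof (cases "\<exists>q\<in>far_side K. ftilde g a J K q < 0")
  case True
  then show ?thesis
    using side_zeros_of_negative_value[OF assms(1-5) far_near_side(1)[OF assms(4,5)]] by metis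
next
  case False
  with assms(6) obtain n :: nat where
    n: "\<And>q::rat. of_rat q \<in> far_side K \<Longrightarrow> 1 / Suc n \<le> ftilde g a J K (of_rat q)"
    unfolding touching_def by (metis not_less)
  have "ftilde g a J K v \<noteq> 0" if v: "v \<in> far_side K" for v
  proof
    assume 0: "ftilde g a J K v = 0"
    have "v > 0" "v \<noteq> K" using v far_near_side[OF assms(4,5)] sidesD assms(4) by blast+
    then have "isCont (ftilde g a J K) v"
      by (intro DERIV_isCont[OF ftilde_has_derivative])
    then obtain d where d: "d > 0"
      "\<And>w. \<bar>w - v\<bar> < d \<Longrightarrow> \<bar>ftilde g a J K w\<bar> < 1 / Suc n"
      using 0 unfolding continuous_at_eps_delta dist_real_def
      by (metis diff_zero divide_pos_pos of_nat_0_less_iff zero_less_Suc zero_less_one)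
    have "open (far_side K)" by (auto simp: far_side_def)
    then obtain e where e: "e > 0" "\<And>w. \<bar>w - v\<bar> < e \<Longrightarrow> w \<in> far_side K"
      using v by (auto simp: open_dist dist_real_def)
    obtain q :: rat where q: "v < of_rat q" "of_rat q < v + min d e"
      using of_rat_dense[of v "v + min d e"] d e by auto
    then have "1 / Suc n \<le> ftilde g a J K (of_rat q)" by (intro n e) auto
    moreover have "\<bar>ftilde g a J K (of_rat q)\<bar> < 1 / Suc n" by (rule d) (use q in auto)
    ultimately show False by simp
  qed
  then show ?thesis by blast
qed

text \<open>
  Points of the far side stay away from \<open>1\<close>, and all lie on the same side of \<open>1\<close>. There the
  coefficient \<open>v\<^sup>-\<^sup>\<gamma> - 1\<close> of \<open>a\<close> in \<open>ftilde\<close> has a constant sign \<open>\<sigma>\<close> and modulus at least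
  \<open>m = \<bar>K\<^sup>-\<^sup>\<gamma> - 1\<bar> > 0\<close>. Changing \<open>a\<close> thus moves the infimum of \<open>ftilde\<close> strictly
  monotonically, and it can vanish for at most one \<open>a\<close>.
\<close>

lemma touching_unique:
  assumes "g \<ge> 1" "K \<ge> 0" "K \<noteq> 1" "touching g a J K" "touching g b J K"
  shows "a = b"
proof -
  have diff: "ftilde g b J K v - ftilde g a J K v = (b - a) * (v powr (- g) - 1)" for a b v
    by (simp add: ftilde_def press_def algebra_simps)
  define m where "m = \<bar>K powr (- g) - 1\<bar>"
  have K0: "K > 0" if "touching g a J K" for a
  proof (rule ccontr)
    assume "\<not> K > 0"
    then have "far_side K = {}" using assms by (auto simp: far_side_def)
    then show False using that by (auto simp: touching_def)
  qed
  have less: "\<not> \<sigma> * (b - a) > 0"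
    if t: "touching g a J K" "touching g b J K" and s: "\<sigma> = (if K < 1 then 1 else - 1)" for a b \<sigma>
  proof
    assume ab: "\<sigma> * (b - a) > 0"
    have m: "m > 0" using K0[OF t(1)] assms powr_inj by (auto simp: m_def powr_eq_one_iff_gen)
    \<comment> \<open>\<open>K\<close> is the end of the far side that is closest to \<open>1\<close>.\<close>
    have gap: "\<sigma> * (v powr (- g) - 1) \<ge> m" if "v \<in> far_side K" for v
    proof (cases "K < 1")
      case True
      have "K powr (-g) \<le> v powr (-g)" using that True assms
        by (intro powr_mono2') (auto simp: far_side_def)
      moreover have "K powr (-g) \<ge> 1" using powr_mono2'[of "-g" K 1] K0[OF t(1)] True assms by simp
      ultimately show ?thesis using True s by (simp add: m_def)
    next
      case False
      have "v powr (-g) \<le> K powr (-g)" using that False assms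
        by (intro powr_mono2') (auto simp: far_side_def)
      moreover have "K powr (-g) \<le> 1" using powr_mono2'[of "-g" 1 K] False assms by simp
      ultimately show ?thesis using False s by (simp add: m_def)
    qed
    have pos: "\<sigma> * (b - a) * m > 0" using ab m by simp
    then obtain n :: nat where n: "1 / Suc n < \<sigma> * (b - a) * m"
      using nat_approx_posE by metis
    obtain q :: rat where q: "of_rat q \<in> far_side K" "ftilde g b J K (of_rat q) < 1 / Suc n"
      using t(2) unfolding touching_def by blast
    have "\<sigma> * (b - a) * m \<le> \<sigma> * (b - a) * (\<sigma> * ((of_rat q) powr (- g) - 1))"
      using gap[OF q(1)] ab by (intro mult_left_mono) auto
    also have "\<dots> = (b - a) * ((of_rat q) powr (- g) - 1)" using s by auto
    also have "\<dots> = ftilde g b J K (of_rat q) - ftilde g a J K (of_rat q)" by (simp only: diff)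
    finally have "ftilde g a J K (of_rat q) < 0" using q n by linarith
    then show False using q t(1) unfolding touching_def by force
  qed
  show ?thesis
    using less[OF assms(4,5) refl] less[OF assms(5,4) refl] by (auto split: if_splits)
qed

lemma ftilde_deriv_measurable [measurable]:
  "(\<lambda>x. ftilde_deriv g (fst x) (fst (snd x)) (snd (snd x)) 1) \<in> borel_measurable (borel \<Otimes>\<^sub>M (borel \<Otimes>\<^sub>M borel))"
  unfolding ftilde_deriv_def by measurable

lemma ftilde_measurable [measurable]:
  "(\<lambda>x. ftilde g (fst x) (fst (snd x)) (snd (snd x)) v) \<in> borel_measurable (borel \<Otimes>\<^sub>M (borel \<Otimes>\<^sub>M borel))"
  unfolding ftilde_def press_def by measurable

lemma far_side_measurable [measurable]:
  "Measurable.pred (borel \<Otimes>\<^sub>M (borel \<Otimes>\<^sub>M borel)) (\<lambda>x. v \<in> far_side (snd (snd x)))" for v :: real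
proof -
  have "v \<in> far_side K \<longleftrightarrow> (K < 1 \<and> 0 < v \<and> v < K) \<or> (1 \<le> K \<and> K < v)" for K
    by (auto simp: far_side_def)
  then show ?thesis by simp
qed

text \<open>
  For fixed \<open>(J, K)\<close> each of the two kinds of degeneracy occurs for at most one value of \<open>a\<close>:
  the slope at \<open>1\<close> is an affine function of \<open>a\<close> with leading coefficient \<open>-\<gamma>\<close>, and touching
  is covered by the preceding uniqueness. Since the exceptional set is Borel and its sections in
  the \<open>a\<close>-direction are finite, it is null by Fubini.
\<close>

lemma AE_nondegenerate:
  assumes "g \<ge> 1"
  shows "AE (a, J, K) in (lborel :: (real \<times> real \<times> real) measure).
    0 \<le> K \<and> K \<noteq> 1 \<longrightarrow> nondegenerate g a J K"
proof -
  let ?P = "\<lambda>a z. 0 \<le> snd z \<and> snd z \<noteq> (1::real) \<longrightarrow> nondegenerate g a (fst z) (snd z)"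
  let ?M = "lborel \<Otimes>\<^sub>M (lborel \<Otimes>\<^sub>M lborel) :: (real \<times> real \<times> real) measure"
  interpret pair_sigma_finite "lborel :: real measure" "lborel \<Otimes>\<^sub>M lborel :: (real \<times> real) measure"
    unfolding lborel_prod ..
  have sets: "sets ?M = sets (borel \<Otimes>\<^sub>M (borel \<Otimes>\<^sub>M borel))"
    by (intro sets_pair_measure_cong) auto
  have [measurable]: "Measurable.pred (borel \<Otimes>\<^sub>M (borel \<Otimes>\<^sub>M borel)) (\<lambda>x. ?P (fst x) (snd x))"
    unfolding nondegenerate_def touching_def by measurable
  have meas: "{x \<in> space ?M. ?P (fst x) (snd x)} \<in> sets ?M"
    using sets by (subst sets, subst sets_eq_imp_space_eq[OF sets]) measurable
  have section_null: "AE a in lborel. ?P a z" for z :: "real \<times> real"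
  proof (cases "0 \<le> snd z \<and> snd z \<noteq> 1")
    case True
    define c where "c = (1 - 2 * fst z * (1 - snd z)\<^sup>2 / (1 - snd z) ^ 3) / g"
    have c: "a = c" if "ftilde_deriv g a (fst z) (snd z) 1 = 0" for a
      using that assms by (simp add: c_def ftilde_deriv_def field_simps)
    obtain b where b: "\<And>a. touching g a (fst z) (snd z) \<Longrightarrow> a = b"
      using touching_unique[OF assms] True by metis
    have "AE a in lborel. a \<noteq> c" "AE a in lborel. a \<noteq> b" by (rule AE_lborel_singleton)+
    then show ?thesis
      by eventually_elim (use b c in \<open>auto simp: nondegenerate_def\<close>)
  qed auto
  have "AE z in lborel \<Otimes>\<^sub>M lborel. AE a in lborel. ?P a z"
    using section_null by simp
  then have "AE a in lborel. AE z in lborel \<Otimes>\<^sub>M lborel. ?P a z"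
    using AE_commute[OF meas] by simp
  then have "AE x in ?M. ?P (fst x) (snd x)"
    using AE_pair_measure[OF meas] by simp
  then show ?thesis
    unfolding lborel_prod by (simp add: case_prod_beta)
qed

text \<open>
  The labels record the side and the position within the pair: \<open>1, 2\<close> to the left of \<open>K\<close>
  and \<open>3, 4\<close> to its right. By convexity the slope is negative at the smaller root of a pair
  and positive at the larger one.
\<close>

lemma generic_roots:
  assumes "g \<ge> 1" "a > 0" "J > 0" "K \<ge> 0" "K \<noteq> 1" "nondegenerate g a J K"
  obtains A :: "nat set" and v where "A \<in> {{1, 2}, {3, 4}, {1, 2, 3, 4}}"
    "froots g a J K = v ` A" "strict_mono_on A v"
    "\<And>j. j \<in> A \<Longrightarrow> j \<in> {1, 2} \<Longrightarrow> v j < K" "\<And>j. j \<in> A \<Longrightarrow> j \<in> {3, 4} \<Longrightarrow> K < v j"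
    "\<And>j. j \<in> A \<Longrightarrow> j \<in> {1, 3} \<Longrightarrow> ftilde_deriv g a J K (v j) < 0"
    "\<And>j. j \<in> A \<Longrightarrow> j \<in> {2, 4} \<Longrightarrow> ftilde_deriv g a J K (v j) > 0"
proof -
  define L where "L = {v \<in> {0<..<K}. ftilde g a J K v = 0}"
  define R where "R = {v \<in> {K<..}. ftilde g a J K v = 0}"
  define pair where "pair S Z \<longleftrightarrow> (\<exists>x y. x \<in> S \<and> y \<in> S \<and> x < y \<and> Z = {x, y} \<and>
    ftilde_deriv g a J K x < 0 \<and> ftilde_deriv g a J K y > 0)" for S Z
  have pair_nonempty: "Z \<noteq> {}" if "pair S Z" for S Z
    using that unfolding pair_def by blast
  note side = far_near_side[OF assms(4,5)]
  have far: "{v \<in> far_side K. ftilde g a J K v = 0} = {} \<or>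
      pair (far_side K) {v \<in> far_side K. ftilde g a J K v = 0}" (is "?Z = {} \<or> _")
  proof (cases "?Z = {}")
    case False
    then obtain x y where xy: "x \<in> far_side K" "y \<in> far_side K" "x < y" "?Z = {x, y}"
      using far_side_zeros[OF assms(1-5)] assms(6) unfolding nondegenerate_def by metis
    then have "ftilde g a J K x = 0" "ftilde g a J K y = 0" by blast+
    then show ?thesis
      unfolding pair_def using ftilde_two_zeros(1,2)[OF assms(1-4) side(1)] xy by blast
  qed simp
  obtain x y where xy: "x \<in> near_side K" "y \<in> near_side K" "x < y"
    "{v \<in> near_side K. ftilde g a J K v = 0} = {x, y}"
    using near_side_two_zeros[OF assms(1-5)] assms(6) unfolding nondegenerate_def by metis
  then have "ftilde g a J K x = 0" "ftilde g a J K y = 0" by blast+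
  then have near: "pair (near_side K) {v \<in> near_side K. ftilde g a J K v = 0}"
    unfolding pair_def using ftilde_two_zeros(1,2)[OF assms(1-4) side(2)] xy by blast
  have one_or_both: "(L = {} \<or> pair {0<..<K} L) \<and> (R = {} \<or> pair {K<..} R) \<and> (L \<noteq> {} \<or> R \<noteq> {})"
  proof (cases "K < 1")
    case True
    then have "far_side K = {0<..<K}" "near_side K = {K<..}"
      by (simp_all add: far_side_def near_side_def)
    with far near have "L = {} \<or> pair {0<..<K} L" "pair {K<..} R"
      by (simp_all only: L_def R_def)
    then show ?thesis using pair_nonempty by blast
  next
    case False
    then have "far_side K = {K<..}" "near_side K = {0<..<K}"
      by (simp_all add: far_side_def near_side_def)
    with far near have "R = {} \<or> pair {K<..} R" "pair {0<..<K} L"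
      by (simp_all only: L_def R_def)
    then show ?thesis using pair_nonempty by blast
  qed
  have fr: "froots g a J K = L \<union> R"
    using assms by (auto simp: froots_def L_def R_def)
  consider (L) "pair {0<..<K} L" "R = {}" | (R) "pair {K<..} R" "L = {}"
    | (LR) "pair {0<..<K} L" "pair {K<..} R"
    using one_or_both by blast
  then show ?thesis
  proof cases
    case L
    then obtain x y where "x \<in> {0<..<K}" "y \<in> {0<..<K}" "x < y" "L = {x, y}"
      "ftilde_deriv g a J K x < 0" "ftilde_deriv g a J K y > 0" unfolding pair_def by blast
    then show ?thesis using fr L
      by (intro that[of "{1, 2}" "(\<lambda>_. 0)(1 := x, 2 := y)"]) (auto simp: strict_mono_on_def)
  next
    case R
    then obtain x y where "x \<in> {K<..}" "y \<in> {K<..}" "x < y" "R = {x, y}"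
      "ftilde_deriv g a J K x < 0" "ftilde_deriv g a J K y > 0" unfolding pair_def by blast
    then show ?thesis using fr R
      by (intro that[of "{3, 4}" "(\<lambda>_. 0)(3 := x, 4 := y)"]) (auto simp: strict_mono_on_def)
  next
    case LR
    then obtain x y x' y' where "x \<in> {0<..<K}" "y \<in> {0<..<K}" "x < y" "L = {x, y}"
      "ftilde_deriv g a J K x < 0" "ftilde_deriv g a J K y > 0"
      "x' \<in> {K<..}" "y' \<in> {K<..}" "x' < y'" "R = {x', y'}"
      "ftilde_deriv g a J K x' < 0" "ftilde_deriv g a J K y' > 0" unfolding pair_def by blast
    then show ?thesis using fr
      by (intro that[of "{1, 2, 3, 4}" "(\<lambda>_. 0)(1 := x, 2 := y, 3 := x', 4 := y')"])
        (auto simp: strict_mono_on_def)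
  qed
qed

section \<open>Linearization\<close>

text \<open>
  The characteristic equation. For the converse an eigenvector is read off from a nonzero row
  of \<open>A - l\<close>; if both rows vanish, then \<open>A\<close> is scalar and any vector will do.
\<close>

lemma cx_eigenvalue_2:
  fixes A :: "real^2^2" and l :: complex
  defines "a \<equiv> complex_of_real (A $ 1 $ 1)" and "b \<equiv> complex_of_real (A $ 1 $ 2)"
    and "c \<equiv> complex_of_real (A $ 2 $ 1)" and "d \<equiv> complex_of_real (A $ 2 $ 2)"
  shows "cx_eigenvalue A l \<longleftrightarrow> (l - a) * (l - d) = b * c"
proof -
  have ev: "map_matrix complex_of_real A *v z = l *s z \<longleftrightarrow>
      a * z $ 1 + b * z $ 2 = l * z $ 1 \<and> c * z $ 1 + d * z $ 2 = l * z $ 2" for z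
    by (simp add: vec_eq_iff forall_2 matrix_vector_mult_def sum_2 map_matrix_def a_def b_def c_def d_def)
  show ?thesis
  proof
    assume "cx_eigenvalue A l"
    then obtain z :: "complex^2" where z: "z \<noteq> 0"
      "a * z $ 1 + b * z $ 2 = l * z $ 1" "c * z $ 1 + d * z $ 2 = l * z $ 2"
      unfolding cx_eigenvalue_def ev by blast
    have bz: "b * z $ 2 = (l - a) * z $ 1" and cz: "c * z $ 1 = (l - d) * z $ 2"
      using z by (auto simp: algebra_simps)
    have "((l - a) * (l - d) - b * c) * z $ 1 = (l - d) * ((l - a) * z $ 1) - b * (c * z $ 1)"
      by (simp add: algebra_simps)
    then have 1: "((l - a) * (l - d) - b * c) * z $ 1 = 0"
      by (simp add: bz[symmetric] cz mult.left_commute)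
    have "((l - a) * (l - d) - b * c) * z $ 2 = (l - a) * ((l - d) * z $ 2) - c * (b * z $ 2)"
      by (simp add: algebra_simps)
    then have 2: "((l - a) * (l - d) - b * c) * z $ 2 = 0"
      by (simp add: cz[symmetric] bz mult.left_commute)
    have "z $ 1 \<noteq> 0 \<or> z $ 2 \<noteq> 0" using z(1) by (auto simp: vec_eq_iff forall_2)
    then show "(l - a) * (l - d) = b * c" using 1 2 by auto
  next
    assume det: "(l - a) * (l - d) = b * c"
    define z :: "complex^2" where "z =
      (if b \<noteq> 0 \<or> l \<noteq> a then vector [b, l - a] else if c \<noteq> 0 \<or> l \<noteq> d then vector [l - d, c]
       else vector [1, 0])"
    have "z \<noteq> 0" by (auto simp: z_def vec_eq_iff forall_2)
    moreover have "a * z $ 1 + b * z $ 2 = l * z $ 1 \<and> c * z $ 1 + d * z $ 2 = l * z $ 2"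
      using det by (auto simp: z_def algebra_simps)
    ultimately show "cx_eigenvalue A l" unfolding cx_eigenvalue_def ev by blast
  qed
qed

text \<open>
  When the off-diagonal entries do not have opposite signs, the discriminant
  \<open>(a - d)\<^sup>2 + 4 b c\<close> is nonnegative and the spectrum is real.
\<close>

lemma cx_eigenvalues_real_pair:
  fixes A :: "real^2^2"
  assumes "A $ 1 $ 2 * A $ 2 $ 1 \<ge> 0"
  obtains r s :: real where "r \<le> s" "r + s = A $ 1 $ 1 + A $ 2 $ 2"
    "r * s = A $ 1 $ 1 * A $ 2 $ 2 - A $ 1 $ 2 * A $ 2 $ 1"
    "\<And>l. cx_eigenvalue A l \<longleftrightarrow> l = of_real r \<or> l = of_real s"
proof -
  define a d e where "a = A $ 1 $ 1" and "d = A $ 2 $ 2" and "e = A $ 1 $ 2 * A $ 2 $ 1"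
  define D where "D = sqrt ((a - d)\<^sup>2 + 4 * e)"
  have D: "D \<ge> 0" "D * D = (a - d)\<^sup>2 + 4 * e"
    using assms by (simp_all add: D_def e_def)
  define r s where "r = (a + d - D) / 2" and "s = (a + d + D) / 2"
  have le: "r \<le> s" using D by (simp add: r_def s_def)
  have sum: "r + s = a + d" by (simp add: r_def s_def field_simps)
  have "r * s = ((a + d) * (a + d) - D * D) / 4" by (simp add: r_def s_def field_simps)
  then have prod: "r * s = a * d - e" by (simp add: D power2_eq_square algebra_simps)
  have ev: "cx_eigenvalue A l \<longleftrightarrow> l = of_real r \<or> l = of_real s" for l
  proof -
    have "(l - of_real r) * (l - of_real s) = l * l - of_real (r + s) * l + of_real (r * s)"
      by (simp add: algebra_simps)
    also have "\<dots> = (l - of_real a) * (l - of_real d) - of_real e"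
      unfolding sum prod by (simp add: algebra_simps)
    finally have factor: "(l - of_real r) * (l - of_real s) = \<dots>" .
    have "cx_eigenvalue A l \<longleftrightarrow> (l - of_real a) * (l - of_real d) - of_real e = 0"
      unfolding cx_eigenvalue_2 a_def d_def e_def of_real_mult right_minus_eq ..
    then show ?thesis unfolding factor[symmetric] by (simp only: mult_eq_0_iff right_minus_eq)
  qed
  show ?thesis
    by (rule that[OF le sum[unfolded a_def d_def] prod[unfolded a_def d_def e_def] ev])
qed

text \<open>
  With a real spectrum the sign of the determinant separates saddles from nodes. For a positive
  determinant, \<open>b c \<ge> 0\<close> forces the two diagonal entries to have the same sign, so either of
  them decides the stability.
\<close>

lemma hyperbolic_type_2:
  fixes A :: "real^2^2"
  defines "\<Delta> \<equiv> A $ 1 $ 1 * A $ 2 $ 2 - A $ 1 $ 2 * A $ 2 $ 1"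
  assumes sym: "A $ 1 $ 2 * A $ 2 $ 1 \<ge> 0"
    and zero: "F x = 0" and deriv: "(F has_derivative (\<lambda>h. A *v h)) (at x)"
  shows "\<Delta> > 0 \<Longrightarrow> A $ 2 $ 2 < 0 \<Longrightarrow> attractor F x"
    and "\<Delta> > 0 \<Longrightarrow> A $ 2 $ 2 > 0 \<Longrightarrow> repellor F x"
    and "\<Delta> < 0 \<Longrightarrow> saddle F x"
proof -
  obtain r s where rs: "r \<le> s" "r + s = A $ 1 $ 1 + A $ 2 $ 2" "r * s = \<Delta>"
    "\<And>l. cx_eigenvalue A l \<longleftrightarrow> l = of_real r \<or> l = of_real s"
    using cx_eigenvalues_real_pair[OF sym] unfolding \<Delta>_def by blast
  {
    assume "\<Delta> > 0" "A $ 2 $ 2 < 0"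
    moreover from this have "A $ 1 $ 1 * A $ 2 $ 2 > 0" using sym unfolding \<Delta>_def by linarith
    ultimately have "A $ 1 $ 1 < 0" by (auto simp: zero_less_mult_iff)
    then have "r < 0" "s < 0"
      using rs \<open>\<Delta> > 0\<close> \<open>A $ 2 $ 2 < 0\<close> by (auto simp: zero_less_mult_iff)
    then show "attractor F x"
      unfolding attractor_def using zero deriv rs(4) by (intro conjI exI[of _ A]) auto
  }
  {
    assume "\<Delta> > 0" "A $ 2 $ 2 > 0"
    moreover from this have "A $ 1 $ 1 * A $ 2 $ 2 > 0" using sym unfolding \<Delta>_def by linarith
    ultimately have "A $ 1 $ 1 > 0" by (auto simp: zero_less_mult_iff)
    then have "r > 0" "s > 0"
      using rs \<open>\<Delta> > 0\<close> \<open>A $ 2 $ 2 > 0\<close> by (auto simp: zero_less_mult_iff)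
    then show "repellor F x"
      unfolding repellor_def using zero deriv rs(4) by (intro conjI exI[of _ A]) auto
  }
  {
    assume "\<Delta> < 0"
    then have "r < 0" "s > 0" using rs by (auto simp: mult_less_0_iff)
    then show "saddle F x"
      unfolding saddle_def using zero deriv rs(4)
      by (intro conjI exI[of _ A] exI[of _ "of_real r"] exI[of _ "of_real s"]) auto
  }
qed

lemma has_derivative_vec2I:
  fixes F :: "real^2 \<Rightarrow> real^2"
  assumes "((\<lambda>x. F x $ 1) has_derivative (\<lambda>h. (A *v h) $ 1)) (at x)"
    and "((\<lambda>x. F x $ 2) has_derivative (\<lambda>h. (A *v h) $ 2)) (at x)"
  shows "(F has_derivative (\<lambda>h. A *v h)) (at x)"
proof -
  have "\<forall>i. ((\<lambda>x. F x $ i) has_derivative (\<lambda>h. (A *v h) $ i)) (at x)"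
    using assms by (simp add: forall_2)
  then show ?thesis
    unfolding has_derivative_componentwise_within[of F]
    by (auto simp: Basis_vec_def inner_axis)
qed

text \<open>
  The linearization at a rest point. It is \<open>diag (1/\<tau>, 1/\<mu>)\<close> times a symmetric matrix,
  reflecting that the system is \<open>\<tau> v' = v \<phi>\<^sub>v\<close>, \<open>\<mu> w' = v \<phi>\<^sub>w\<close> for the relative entropy
  \<open>\<phi>\<close>. The jump conditions have been used to express the entries through \<open>v\<close> and \<open>B\<close>, so
  the formula is meaningful at rest points only.
\<close>

definition rest_jacobian :: "mhd \<Rightarrow> real \<Rightarrow> real \<Rightarrow> real^2^2" where
  "rest_jacobian P v B = vector
     [vector [(v * (1 - pcoef P * gexp P * v powr (- gexp P - 1)) - B\<^sup>2 / mu0 P) / tau P,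
              Ilong P * B / mu0 P / tau P],
      vector [Ilong P * B / mu0 P / visc P, (v - Kpar P) / visc P]]"

lemma tw_field_has_derivative:
  assumes adm: "admissible P" and rs: "right_state P v u w B"
  shows "(tw_field P has_derivative (\<lambda>h. rest_jacobian P v B *v h)) (at (vector [v, w]))"
proof (rule has_derivative_vec2I)
  note pos = admissible_pos[OF adm]
  let ?x = "vector [v, w] :: real^2"
  note R = rs[unfolded right_state_iff]
  have v: "v > 0" using R by simp
  have comp: "((\<lambda>x. x $ i) has_derivative (\<lambda>h. h $ i)) (at ?x)" for i
    by (rule bounded_linear_imp_has_derivative[OF bounded_linear_vec_nth])
  have "v * B - Bleft P = Ilong P * w" using R by blast
  then have vB: "Bleft P + Ilong P * w = v * B" by linarith
  have wB: "w + Ilong P / mu0 P * Bleft P = Ilong P * B / mu0 P"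
  proof -
    have "w = Ilong P / mu0 P * (B - Bleft P)" using R by blast
    then show ?thesis by (simp add: right_diff_distrib diff_divide_distrib)
  qed
  define p' where "p' = - (pcoef P * gexp P * v powr (- gexp P - 1))"
  have p: "((\<lambda>x. pressP P (x $ 1)) has_derivative (\<lambda>h. h $ 1 * p')) (at ?x)"
    unfolding p'_def by (rule DERIV_compose_FDERIV[OF _ comp]) (simp add: v press_has_derivative)
  have x2: "?x $ 1 = v" "?x $ 2 = w" by simp_all
  define m where "m = 1 / (2 * mu0 P)"
  have recip: "((\<lambda>x. 1 / (2 * mu0 P * x $ 1)) has_derivative (\<lambda>h. h $ 1 * - (m / v\<^sup>2))) (at ?x)"
  proof (rule DERIV_compose_FDERIV[OF _ comp, where f = "\<lambda>v. 1 / (2 * mu0 P * v)"], unfold x2)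
    have "((\<lambda>v. m * inverse v) has_real_derivative m * - (inverse v * 1 * inverse v)) (at v)"
      using v by (intro DERIV_cmult DERIV_inverse' DERIV_ident) simp
    then show "((\<lambda>v. 1 / (2 * mu0 P * v)) has_real_derivative - (m / v\<^sup>2)) (at v)"
      by (simp add: m_def field_simps power2_eq_square)
  qed
  have square: "((\<lambda>x. (Bleft P + Ilong P * x $ 2)\<^sup>2 - (x $ 1)\<^sup>2 * (Bleft P)\<^sup>2) has_derivative
      (\<lambda>h. 2 * (Bleft P + Ilong P * w) * (Ilong P * h $ 2) - 2 * v * h $ 1 * (Bleft P)\<^sup>2)) (at ?x)"
    unfolding power2_eq_square
    by (rule derivative_eq_intros comp refl)+ (simp add: fun_eq_iff algebra_simps)
  have momentum: "(v - 1) + (pressP P v - pressP P 1) = m * ((Bleft P)\<^sup>2 - B\<^sup>2)"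
    using R pos by (simp add: m_def field_simps)
  have "((\<lambda>x. x $ 1 * (x $ 1 - 1) + x $ 1 * (pressP P (x $ 1) - pressP P 1)
     + 1 / (2 * mu0 P * x $ 1) * ((Bleft P + Ilong P * x $ 2)\<^sup>2 - (x $ 1)\<^sup>2 * (Bleft P)\<^sup>2)) has_derivative
      (\<lambda>h. (v * (h $ 1 - 0) + h $ 1 * (v - 1)) + (v * (h $ 1 * p' - 0) + h $ 1 * (pressP P v - pressP P 1))
        + (1 / (2 * mu0 P * v) * (2 * (v * B) * (Ilong P * h $ 2) - 2 * v * h $ 1 * (Bleft P)\<^sup>2)
          + h $ 1 * - (m / v\<^sup>2) * ((v * B)\<^sup>2 - v\<^sup>2 * (Bleft P)\<^sup>2)))) (at ?x)"
    (is "(?N has_derivative ?D) _")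
    by (rule has_derivative_eq_rhs, (rule square recip p comp has_derivative_add
          has_derivative_mult has_derivative_diff has_derivative_const)+) (simp only: x2 vB)
  moreover have "?D = (\<lambda>h. (v * (1 + p') - B\<^sup>2 / mu0 P) * h $ 1 + Ilong P * B / mu0 P * h $ 2)"
  proof
    fix h :: "real^2"
    have "?D h = h $ 1 * ((v - 1) + (pressP P v - pressP P 1)) + v * (1 + p') * h $ 1
        + 2 * m * (B * Ilong P * h $ 2 - h $ 1 * (Bleft P)\<^sup>2) - h $ 1 * m * (B\<^sup>2 - (Bleft P)\<^sup>2)"
    proof -
      have "1 / (2 * mu0 P * v) * (2 * (v * B) * (Ilong P * h $ 2) - 2 * v * h $ 1 * (Bleft P)\<^sup>2)
          = 2 * m * (B * Ilong P * h $ 2 - h $ 1 * (Bleft P)\<^sup>2)"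
        using v pos by (simp add: m_def field_simps)
      moreover have "(v * B)\<^sup>2 - v\<^sup>2 * (Bleft P)\<^sup>2 = v\<^sup>2 * (B\<^sup>2 - (Bleft P)\<^sup>2)"
        by (simp add: power_mult_distrib right_diff_distrib)
      then have "h $ 1 * - (m / v\<^sup>2) * ((v * B)\<^sup>2 - v\<^sup>2 * (Bleft P)\<^sup>2)
          = - (h $ 1 * m * (B\<^sup>2 - (Bleft P)\<^sup>2))"
        using v by simp
      ultimately show ?thesis by (simp only:) (simp add: algebra_simps)
    qed
    also have "\<dots> = (v * (1 + p') - 2 * m * B\<^sup>2) * h $ 1 + 2 * m * (Ilong P * B) * h $ 2"
      unfolding momentum by (simp add: algebra_simps)
    finally show "?D h = (v * (1 + p') - B\<^sup>2 / mu0 P) * h $ 1 + Ilong P * B / mu0 P * h $ 2"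
      by (simp add: m_def)
  qed
  ultimately have "(?N has_derivative
      (\<lambda>h. (v * (1 + p') - B\<^sup>2 / mu0 P) * h $ 1 + Ilong P * B / mu0 P * h $ 2)) (at ?x)"
    by (simp only:)
  from bounded_linear.has_derivative[OF bounded_linear_divide[of "tau P"] this]
  have "((\<lambda>x. tw_field P x $ 1) has_derivative
      (\<lambda>h. ((v * (1 + p') - B\<^sup>2 / mu0 P) * h $ 1 + Ilong P * B / mu0 P * h $ 2) / tau P)) (at ?x)"
    unfolding tw_field_component .
  then show "((\<lambda>x. tw_field P x $ 1) has_derivative (\<lambda>h. (rest_jacobian P v B *v h) $ 1)) (at ?x)"
    by (simp add: rest_jacobian_def matrix_vector_mult_def sum_2 p'_def add_divide_distrib)
  have "((\<lambda>x. x $ 1 * x $ 2 - Ilong P / mu0 P * (Bleft P * (1 - x $ 1) + Ilong P * x $ 2)) has_derivative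
      (\<lambda>h. (w + Ilong P / mu0 P * Bleft P) * h $ 1 + (v - Kpar P) * h $ 2)) (at ?x)"
    by (rule derivative_eq_intros comp refl)+
      (simp add: fun_eq_iff Kpar_def power2_eq_square algebra_simps)
  from bounded_linear.has_derivative[OF bounded_linear_divide[of "visc P"] this]
  have "((\<lambda>x. tw_field P x $ 2) has_derivative
      (\<lambda>h. ((w + Ilong P / mu0 P * Bleft P) * h $ 1 + (v - Kpar P) * h $ 2) / visc P)) (at ?x)"
    unfolding tw_field_component .
  then show "((\<lambda>x. tw_field P x $ 2) has_derivative (\<lambda>h. (rest_jacobian P v B *v h) $ 2)) (at ?x)"
    unfolding wB by (simp add: rest_jacobian_def matrix_vector_mult_def sum_2 add_divide_distrib)
qed

lemma rest_coords_B_sq: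
  assumes adm: "admissible P" and v: "v \<noteq> Kpar P" and rc: "rest_coords P v u w B"
  shows "B\<^sup>2 = 2 * mu0 P * Jpar P * (1 - Kpar P)\<^sup>2 / (v - Kpar P)\<^sup>2"
proof -
  have "B = (1 - Kpar P) / (v - Kpar P) * Bleft P" using rest_coords_iff[OF adm v] rc by blast
  then have "B\<^sup>2 = (1 - Kpar P)\<^sup>2 / (v - Kpar P)\<^sup>2 * (Bleft P)\<^sup>2"
    by (simp add: power_mult_distrib power_divide)
  then show ?thesis by (simp add: Bleft_sq[OF adm])
qed

text \<open>
  This identity links the planar dynamics to the scalar function: since \<open>I\<^sup>2 = \<mu>\<^sub>0 K\<close>, the
  off-diagonal product contributes \<open>K B\<^sup>2 / \<mu>\<^sub>0\<close>, which combines with the first diagonal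
  entry into \<open>v (v - K) (1 + p') - v B\<^sup>2 / \<mu>\<^sub>0\<close>; inserting
  \<open>B\<^sup>2 = 2 \<mu>\<^sub>0 J (1 - K)\<^sup>2 / (v - K)\<^sup>2\<close> produces the derivative of \<open>ftilde\<close>.
\<close>

lemma det_rest_jacobian:
  assumes adm: "admissible P" and v: "v \<noteq> Kpar P" and rc: "rest_coords P v u w B"
  defines "A \<equiv> rest_jacobian P v B"
  shows "A $ 1 $ 1 * A $ 2 $ 2 - A $ 1 $ 2 * A $ 2 $ 1 =
    v * (v - Kpar P) * ftilde_deriv (gexp P) (pcoef P) (Jpar P) (Kpar P) v / (tau P * visc P)"
proof -
  note pos = admissible_pos[OF adm]
  define q where "q = pcoef P * gexp P * v powr (- gexp P - 1)"
  have K: "v - Kpar P \<noteq> 0" using v by simp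
  define e where "e = v - Kpar P"
  define X where "X = B\<^sup>2 / mu0 P"
  have X: "X = 2 * Jpar P * (1 - Kpar P)\<^sup>2 / e\<^sup>2"
    unfolding X_def rest_coords_B_sq[OF adm v rc] e_def using pos by simp
  have I: "(Ilong P * B / mu0 P) * (Ilong P * B / mu0 P) = Kpar P * X"
    by (simp add: X_def Kpar_def power2_eq_square)
  have "A $ 1 $ 1 * A $ 2 $ 2 - A $ 1 $ 2 * A $ 2 $ 1
     = ((v * (1 - q) - X) * e - (Ilong P * B / mu0 P) * (Ilong P * B / mu0 P)) / (tau P * visc P)"
  proof -
    have "p / t * (e / m) - i / t * (i / m) = (p * e - i * i) / (t * m)" for p i t m :: real
      by (simp add: diff_divide_distrib)
    then show ?thesis
      unfolding A_def rest_jacobian_def q_def X_def e_def vector_2 by blast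
  qed
  also have "\<dots> = (v * (1 - q) * e - v * X) / (tau P * visc P)"
    unfolding I by (simp add: e_def algebra_simps)
  also have "v * (1 - q) * e - v * X = v * e * (1 - q - 2 * Jpar P * (1 - Kpar P)\<^sup>2 / e ^ 3)"
    using K unfolding X e_def[symmetric] by (simp add: field_simps power2_eq_square power3_eq_cube)
  finally show ?thesis by (simp add: ftilde_deriv_def q_def e_def)
qed

text \<open>
  The sign of the determinant is that of \<open>(v - K) ftilde'(v)\<close>, and the sign of the second
  diagonal entry is that of \<open>v - K\<close>.
\<close>

lemma rest_point_type:
  assumes adm: "admissible P"
    and v: "v \<in> froots (gexp P) (pcoef P) (Jpar P) (Kpar P)" and rc: "rest_coords P v u w B"
  defines "f' \<equiv> ftilde_deriv (gexp P) (pcoef P) (Jpar P) (Kpar P) v"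
  shows "v < Kpar P \<Longrightarrow> f' < 0 \<Longrightarrow> attractor (tw_field P) (vector [v, w])"
    and "v < Kpar P \<Longrightarrow> f' > 0 \<Longrightarrow> saddle (tw_field P) (vector [v, w])"
    and "v > Kpar P \<Longrightarrow> f' < 0 \<Longrightarrow> saddle (tw_field P) (vector [v, w])"
    and "v > Kpar P \<Longrightarrow> f' > 0 \<Longrightarrow> repellor (tw_field P) (vector [v, w])"
proof -
  note pos = admissible_pos[OF adm]
  have vK: "v \<noteq> Kpar P" "v > 0" using v by (auto simp: froots_def)
  have rs: "right_state P v u w B" using right_state_iff_rest_coords[OF adm] v rc by blast
  define A where "A = rest_jacobian P v B"
  have zero: "tw_field P (vector [v, w]) = 0"
    using rest_point_iff_right_state[OF adm] rs unfolding rest_point_def by blast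
  have sym: "A $ 1 $ 2 * A $ 2 $ 1 \<ge> 0"
    using pos by (simp add: A_def rest_jacobian_def flip: power2_eq_square)
  have A22: "A $ 2 $ 2 = (v - Kpar P) / visc P" by (simp add: A_def rest_jacobian_def)
  note type = hyperbolic_type_2[OF sym zero tw_field_has_derivative[OF adm rs, folded A_def],
      unfolded det_rest_jacobian[OF adm vK(1) rc, folded A_def f'_def], unfolded A22]
  show "v < Kpar P \<Longrightarrow> f' < 0 \<Longrightarrow> attractor (tw_field P) (vector [v, w])"
    "v < Kpar P \<Longrightarrow> f' > 0 \<Longrightarrow> saddle (tw_field P) (vector [v, w])"
    "v > Kpar P \<Longrightarrow> f' < 0 \<Longrightarrow> saddle (tw_field P) (vector [v, w])"
    "v > Kpar P \<Longrightarrow> f' > 0 \<Longrightarrow> repellor (tw_field P) (vector [v, w])"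
    by (rule type; use pos vK in \<open>simp add: zero_less_mult_iff mult_less_0_iff divide_less_0_iff zero_less_divide_iff\<close>)+
qed

section \<open>Relative entropy\<close>

lemma pressure_integral_has_derivative:
  assumes "v > 0"
  shows "((\<lambda>v. LBINT z=1..v. press g a z) has_real_derivative press g a v) (at v)"
proof -
  \<comment> \<open>an interval of positive numbers that contains \<open>1\<close> and has \<open>v\<close> in its interior\<close>
  define l r where "l = min 1 v / 2" and "r = max 1 v + 1"
  have lr: "0 < l" "l < v" "l \<le> 1" "v < r" "1 \<le> r" using assms by (auto simp: l_def r_def min_def)
  have "continuous_on {l..r} (press g a)"
    using lr by (intro continuous_at_imp_continuous_on ballI DERIV_isCont[OF press_has_derivative]) auto
  from interval_integral_FTC2[OF lr(3,5) this, of v] lr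
  have "((\<lambda>v. LBINT z=1..v. press g a z) has_vector_derivative press g a v) (at v within {l..r})"
    by (simp add: one_ereal_def)
  moreover have "at v within {l..r} = at v"
    using lr by (intro at_within_interior) auto
  ultimately show ?thesis by (simp add: has_real_derivative_iff_has_vector_derivative)
qed

text \<open>
  The relative entropy along the curve on which \<open>w\<close> is the function of \<open>v\<close> prescribed by
  the rest point relations.
\<close>

definition rest_entropy :: "real \<Rightarrow> real \<Rightarrow> real \<Rightarrow> real \<Rightarrow> real \<Rightarrow> real" where
  "rest_entropy g a J K v = (LBINT z=1..v. press g a z) - a * (v - 1) + (v - 1)\<^sup>2 / 2
     - J * (v + K + (1 - K)\<^sup>2 / (v - K))"

text \<open>
  Write \<open>e = v - K\<close>. The two terms with \<open>w\<close> collapse to \<open>- J K (1 - v)\<^sup>2 / (v e)\<close>, and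
  \<open>K (1 - v)\<^sup>2 + (v\<^sup>2 + 1) e = v ((v + K) e + (1 - K)\<^sup>2)\<close> cancels the remaining pole
  at \<open>v = 0\<close>.
\<close>

lemma rel_entropy_rest_point:
  assumes adm: "admissible P" and v: "v \<noteq> Kpar P" "v > 0" and rc: "rest_coords P v u w B"
  shows "rel_entropy P v w = rest_entropy (gexp P) (pcoef P) (Jpar P) (Kpar P) v"
proof -
  note pos = admissible_pos[OF adm]
  define K J e where "K = Kpar P" and "J = Jpar P" and "e = v - K"
  have e: "e \<noteq> 0" "v = e + K" using v by (auto simp: e_def K_def)
  have w: "w = Ilong P / mu0 P * ((1 - v) / e) * Bleft P"
    using rest_coords_iff[OF adm v(1)] rc by (simp add: e_def K_def)
  have "w\<^sup>2 = (Ilong P)\<^sup>2 / (mu0 P)\<^sup>2 * ((1 - v) / e)\<^sup>2 * (Bleft P)\<^sup>2"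
    unfolding w by (simp add: power_mult_distrib power_divide)
  then have w2: "w\<^sup>2 = 2 * K * J * ((1 - v) / e)\<^sup>2"
    unfolding Ilong_sq[OF adm] Bleft_sq[OF adm] using pos
    by (simp add: K_def J_def power2_eq_square)
  have "Bleft P * Ilong P * w / mu0 P = (Ilong P)\<^sup>2 / (mu0 P)\<^sup>2 * ((1 - v) / e) * (Bleft P)\<^sup>2"
    unfolding w by (simp add: power2_eq_square mult_ac)
  then have w1: "Bleft P * Ilong P * w / mu0 P = 2 * K * J * ((1 - v) / e)"
    unfolding Ilong_sq[OF adm] Bleft_sq[OF adm] using pos
    by (simp add: K_def J_def power2_eq_square)
  have "w\<^sup>2 / 2 * (1 - (Ilong P)\<^sup>2 / (mu0 P * v)) + Bleft P * Ilong P * w / mu0 P * (1 - 1 / v)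
      - (Bleft P)\<^sup>2 / (2 * mu0 P) * (v + 1 / v)
      = K * J * ((1 - v) / e)\<^sup>2 * (1 - K / v) + 2 * K * J * ((1 - v) / e) * (1 - 1 / v)
        - J * (v + 1 / v)"
    unfolding w1 w2 by (simp add: K_def J_def Kpar_def Jpar_def)
  also have "\<dots> = - (J * (v + K + (1 - K)\<^sup>2 / e))"
  proof -
    have "1 - K / v = e / v" using v by (simp add: e_def field_simps)
    then have "K * J * ((1 - v) / e)\<^sup>2 * (1 - K / v) = K * J * (1 - v)\<^sup>2 / (e * v)"
      using e by (simp add: power2_eq_square)
    moreover have "2 * K * J * ((1 - v) / e) * (1 - 1 / v) = - 2 * (K * J * (1 - v)\<^sup>2 / (e * v))"
      using e v by (simp add: field_simps power2_eq_square)
    moreover have "K * J * (1 - v)\<^sup>2 / (e * v) + J * (v + 1 / v) = J * (v + K + (1 - K)\<^sup>2 / e)"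
    proof -
      have "K * (1 - v)\<^sup>2 + (v\<^sup>2 + 1) * e = v * ((v + K) * e + (1 - K)\<^sup>2)"
        by (simp add: e_def power2_eq_square algebra_simps)
      then have "J * ((K * (1 - v)\<^sup>2 + (v\<^sup>2 + 1) * e) / (e * v)) = J * ((v * ((v + K) * e + (1 - K)\<^sup>2)) / (e * v))"
        by simp
      then show ?thesis using e(1) v(2)
        by (simp add: add_divide_distrib distrib_left power2_eq_square mult_ac)
    qed
    moreover have "X + Y - Z = - W" if "X = T" "Y = - 2 * T" "T + Z = W" for X Y Z T W :: real
      using that by simp
    ultimately show ?thesis by blast
  qed
  finally show ?thesis
    by (simp add: rel_entropy_def rest_entropy_def K_def J_def e_def press_def)
qed

text \<open>
  The curve consists of points where \<open>\<phi>\<^sub>w = 0\<close>, so the derivative along it is \<open>\<phi>\<^sub>v\<close>, and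
  this is \<open>ftilde\<close>.
\<close>

lemma rest_entropy_has_derivative:
  assumes "v > 0" "v \<noteq> K"
  shows "(rest_entropy g a J K has_real_derivative ftilde g a J K v) (at v)"
proof -
  have vK: "v - K \<noteq> 0" using assms by simp
  have pole: "((\<lambda>v. (1 - K)\<^sup>2 / (v - K)) has_real_derivative - ((1 - K)\<^sup>2 / (v - K)\<^sup>2)) (at v)"
    by (rule derivative_eq_intros refl vK)+ (simp add: power2_eq_square)
  have quad: "((\<lambda>v. (v - 1)\<^sup>2 / 2) has_real_derivative v - 1) (at v)"
    by (auto intro!: derivative_eq_intros)
  have "rest_entropy g a J K = (\<lambda>v. (LBINT z=1..v. press g a z) - a * (v - 1) + (v - 1)\<^sup>2 / 2
     - J * (v + K + (1 - K)\<^sup>2 / (v - K)))"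
    by (simp add: rest_entropy_def fun_eq_iff)
  moreover have "(\<dots> has_real_derivative press g a v - a * (1 - 0) + (v - 1)
      - J * (1 + 0 + - ((1 - K)\<^sup>2 / (v - K)\<^sup>2))) (at v)"
    by (intro DERIV_diff DERIV_add DERIV_const DERIV_ident DERIV_cmult pole quad
        pressure_integral_has_derivative assms)
  ultimately show ?thesis
    by (simp add: ftilde_def press_def algebra_simps)
qed

lemma rest_entropy_less_same_side:
  assumes "g \<ge> 1" "a > 0" "J > 0" "K \<ge> 0" "S \<in> sides K"
    and xy: "x \<in> S" "y \<in> S" "x < y" "ftilde g a J K x = 0" "ftilde g a J K y = 0"
  shows "rest_entropy g a J K y < rest_entropy g a J K x"
proof -
  have d: "(rest_entropy g a J K has_real_derivative ftilde g a J K z) (at z)"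
    if "x \<le> z" "z \<le> y" for z
  proof -
    have "z \<in> S" using mem_is_interval_1_I[OF sides_is_interval[OF assms(5)] xy(1,2) that] .
    then show ?thesis using sidesD[OF assms(5,4)] by (intro rest_entropy_has_derivative)
  qed
  obtain z where z: "x < z" "z < y"
    "rest_entropy g a J K y - rest_entropy g a J K x = (y - x) * ftilde g a J K z"
    using MVT2[OF xy(3) d] by blast
  have "(y - x) * ftilde g a J K z < 0"
    using ftilde_two_zeros(3)[OF assms z(1,2)] xy by (simp add: mult_pos_neg)
  then show ?thesis using z by linarith
qed

text \<open>
  Integrating \<open>ftilde\<close> across the pole is impossible, but the singular part of the entropy is
  explicit. The regular part \<open>H\<close> has the convex derivative \<open>h\<close>, which is \<open>ftilde\<close> without its
  positive magnetic term and hence negative at both roots; by convexity it is negative in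
  between. The singular part \<open>- J (1 - K)\<^sup>2 / (v - K)\<close> is positive at \<open>x\<close> and negative
  at \<open>y\<close>.
\<close>

lemma rest_entropy_less_across:
  assumes "g \<ge> 1" "a > 0" "J > 0" "K \<noteq> 1"
    and x: "0 < x" "x < K" "ftilde g a J K x = 0" and y: "K < y" "ftilde g a J K y = 0"
  shows "rest_entropy g a J K y < rest_entropy g a J K x"
proof -
  define h where "h z = press g a z - a + z - 1 - J" for z
  define H where "H z = (LBINT z=1..z. press g a z) - a * (z - 1) + (z - 1)\<^sup>2 / 2 - J * z" for z
  have f: "ftilde g a J K z = h z + J * (1 - K)\<^sup>2 / (z - K)\<^sup>2" for z
    by (simp add: ftilde_def h_def press_def algebra_simps)
  have hneg: "h z < 0" if "ftilde g a J K z = 0" "z \<noteq> K" for z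
  proof -
    have "J * (1 - K)\<^sup>2 / (z - K)\<^sup>2 > 0" using assms that by simp
    then show ?thesis using that f[of z] by linarith
  qed
  have dh: "(h has_real_derivative 1 - a * g * z powr (- g - 1)) (at z)" if "z > 0" for z
  proof -
    have "((\<lambda>z. press g a z - a + z - 1 - J) has_real_derivative
        - (a * g * z powr (- g - 1)) - 0 + 1 - 0 - 0) (at z)"
      by (intro DERIV_diff DERIV_add DERIV_const DERIV_ident press_has_derivative that)
    then show ?thesis by (simp add: h_def[abs_def])
  qed
  have dH: "(H has_real_derivative h z) (at z)" if "z > 0" for z
  proof -
    have quad: "((\<lambda>v. (v - 1)\<^sup>2 / 2) has_real_derivative z - 1) (at z)"
      by (auto intro!: derivative_eq_intros)
    have "(H has_real_derivative press g a z - a * (1 - 0) + (z - 1) - J * 1) (at z)"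
      unfolding H_def[abs_def]
      by (intro DERIV_diff DERIV_const DERIV_add DERIV_ident DERIV_cmult quad
          pressure_integral_has_derivative that)
    then show ?thesis by (simp add: h_def algebra_simps)
  qed
  have xy: "x < y" using x y by simp
  have convex: "convex_on {x..y} h"
  proof (rule convex_on_realI)
    fix u v assume uv: "u \<in> {x..y}" "v \<in> {x..y}" "u \<le> v"
    then have "v powr (- g - 1) \<le> u powr (- g - 1)"
      using x assms by (intro powr_mono2') auto
    then show "1 - a * g * u powr (- g - 1) \<le> 1 - a * g * v powr (- g - 1)"
      using assms by (simp add: mult_left_mono)
  qed (use dh x in auto)
  obtain z where z: "x < z" "z < y" "H y - H x = (y - x) * h z"
    using MVT2[OF xy, of H h] dH x by auto
  have "h z \<le> max (h x) (h y)"
    using convex_on_le_max[OF convex] z by simp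
  moreover have "h x < 0" "h y < 0" using hneg x y by auto
  ultimately have "h z < 0" by linarith
  then have "H y < H x" using z mult_pos_neg[of "y - x" "h z"] by linarith
  moreover have "J * (1 - K)\<^sup>2 / (y - K) > 0" "J * (1 - K)\<^sup>2 / (x - K) < 0"
    using assms by (simp_all add: divide_neg_neg mult_less_0_iff divide_less_0_iff)
  moreover have "rest_entropy g a J K z = H z - J * K - J * (1 - K)\<^sup>2 / (z - K)" for z
    by (simp add: rest_entropy_def H_def algebra_simps)
  ultimately show ?thesis by simp
qed

lemma rest_entropy_decreasing:
  assumes "g \<ge> 1" "a > 0" "J > 0" "K \<ge> 0" "K \<noteq> 1"
    and "x \<in> froots g a J K" "y \<in> froots g a J K" "x < y"
  shows "rest_entropy g a J K y < rest_entropy g a J K x"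
proof -
  have r: "x > 0" "y > 0" "x \<noteq> K" "y \<noteq> K" "ftilde g a J K x = 0" "ftilde g a J K y = 0"
    using assms by (auto simp: froots_def)
  consider "y < K" | "K < x" | "x < K" "K < y" using r assms(8) by linarith
  then show ?thesis
  proof cases
    case 1
    then show ?thesis
      by (intro rest_entropy_less_same_side[of g a J K "{0<..<K}"]) (use r assms in \<open>auto simp: sides_def\<close>)
  next
    case 2
    then show ?thesis
      by (intro rest_entropy_less_same_side[of g a J K "{K<..}"]) (use r assms in \<open>auto simp: sides_def\<close>)
  next
    case 3
    then show ?thesis by (intro rest_entropy_less_across) (use r assms in auto)
  qed
qed

section \<open>Classification of the rest points\<close>

theorem proposition3p6:
  fixes g :: real
  assumes "g \<ge> 1"
  shows "(\<forall>P. admissible P \<and> gexp P = g \<longrightarrow>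
      (\<forall>v u w B. rest_point P v w \<and> profile_coords P v u w B \<longleftrightarrow> right_state P v u w B) \<and>
      (\<forall>v u w B. right_state P v u w B \<longleftrightarrow>
         v \<in> froots g (pcoef P) (Jpar P) (Kpar P) \<and> rest_coords P v u w B) \<and>
      (\<forall>v \<in> froots g (pcoef P) (Jpar P) (Kpar P).
         \<exists>!(u, w, B). rest_coords P v u w B))
    \<and> (\<forall>a J K. a > 0 \<and> J > 0 \<and> 0 \<le> K \<and> K \<noteq> 1 \<longrightarrow>
      finite {v \<in> froots g a J K. v > K} \<and> card {v \<in> froots g a J K. v > K} \<le> 2 \<and>
      finite {v \<in> froots g a J K. v < K} \<and> card {v \<in> froots g a J K. v < K} \<le> 2)
    \<and> (AE (a, J, K) in (lborel :: (real \<times> real \<times> real) measure).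
      a > 0 \<and> J > 0 \<and> 0 \<le> K \<and> K \<noteq> 1 \<longrightarrow>
      card (froots g a J K) \<in> {2, 4} \<and>
      (\<forall>P. admissible P \<and> gexp P = g \<and> pcoef P = a \<and> Jpar P = J \<and> Kpar P = K \<longrightarrow>
        (\<exists>A \<in> {{1, 2}, {3, 4}, {1, 2, 3, 4}}. \<exists>v u w B :: nat \<Rightarrow> real.
          froots g a J K = v ` A \<and> strict_mono_on A v \<and>
          (\<forall>j\<in>A. rest_coords P (v j) (u j) (w j) (B j)) \<and>
          (\<forall>j\<in>A. (j \<in> {1, 2} \<longrightarrow> v j < K) \<and> (j \<in> {3, 4} \<longrightarrow> K < v j)) \<and>
          (1 \<in> A \<longrightarrow> attractor (tw_field P) (vector [v 1, w 1])) \<and>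
          (2 \<in> A \<longrightarrow> saddle (tw_field P) (vector [v 2, w 2])) \<and>
          (3 \<in> A \<longrightarrow> saddle (tw_field P) (vector [v 3, w 3])) \<and>
          (4 \<in> A \<longrightarrow> repellor (tw_field P) (vector [v 4, w 4])) \<and>
          (\<forall>i\<in>A. \<forall>j\<in>A. i < j \<longrightarrow>
             rel_entropy P (v j) (w j) < rel_entropy P (v i) (w i)))))"
proof (intro conjI allI impI)
  fix P v u w B assume "admissible P \<and> gexp P = g"
  then have P: "admissible P" and g: "g = gexp P" by auto
  show "rest_point P v w \<and> profile_coords P v u w B \<longleftrightarrow> right_state P v u w B"
    by (rule rest_point_iff_right_state[OF P])
  show "right_state P v u w B \<longleftrightarrow>
      v \<in> froots g (pcoef P) (Jpar P) (Kpar P) \<and> rest_coords P v u w B"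
    unfolding g by (rule right_state_iff_rest_coords[OF P])
next
  fix P assume "admissible P \<and> gexp P = g"
  then show "\<forall>v \<in> froots g (pcoef P) (Jpar P) (Kpar P). \<exists>!(u, w, B). rest_coords P v u w B"
    using unique_rest_coords by (auto simp: froots_def)
next
  fix a J K :: real assume par: "a > 0 \<and> J > 0 \<and> 0 \<le> K \<and> K \<noteq> 1"
  then have "0 \<le> K" by blast
  from par have "finite {v \<in> froots g a J K. v > K} \<and> card {v \<in> froots g a J K. v > K} \<le> 2"
    "finite {v \<in> froots g a J K. v < K} \<and> card {v \<in> froots g a J K. v < K} \<le> 2"
    unfolding froots_side[OF \<open>0 \<le> K\<close>]
    by (intro side_zeros_card_le_2[OF assms]; simp add: sides_def)+
  then show "finite {v \<in> froots g a J K. v > K}" "card {v \<in> froots g a J K. v > K} \<le> 2"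
    "finite {v \<in> froots g a J K. v < K}" "card {v \<in> froots g a J K. v < K} \<le> 2"
    by blast+
next
  let ?labelled = "\<lambda>P a J K. \<exists>A \<in> {{1, 2}, {3, 4}, {1, 2, 3, 4}}. \<exists>v u w B :: nat \<Rightarrow> real.
          froots g a J K = v ` A \<and> strict_mono_on A v \<and>
          (\<forall>j\<in>A. rest_coords P (v j) (u j) (w j) (B j)) \<and>
          (\<forall>j\<in>A. (j \<in> {1, 2} \<longrightarrow> v j < K) \<and> (j \<in> {3, 4} \<longrightarrow> K < v j)) \<and>
          (1 \<in> A \<longrightarrow> attractor (tw_field P) (vector [v 1, w 1])) \<and>
          (2 \<in> A \<longrightarrow> saddle (tw_field P) (vector [v 2, w 2])) \<and>
          (3 \<in> A \<longrightarrow> saddle (tw_field P) (vector [v 3, w 3])) \<and>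
          (4 \<in> A \<longrightarrow> repellor (tw_field P) (vector [v 4, w 4])) \<and>
          (\<forall>i\<in>A. \<forall>j\<in>A. i < j \<longrightarrow>
             rel_entropy P (v j) (w j) < rel_entropy P (v i) (w i))"
  let ?generic = "\<lambda>a J K. card (froots g a J K) \<in> {2, 4} \<and>
      (\<forall>P. admissible P \<and> gexp P = g \<and> pcoef P = a \<and> Jpar P = J \<and> Kpar P = K \<longrightarrow> ?labelled P a J K)"
  have generic: "?generic a J K"
    if par: "a > 0" "J > 0" "0 \<le> K" "K \<noteq> 1" and nondeg: "nondegenerate g a J K" for a J K
  proof -
    obtain A v where A: "A \<in> {{1, 2}, {3, 4}, {1, 2, 3, 4::nat}}"
      "froots g a J K = v ` A" "strict_mono_on A v"
      "\<And>j. j \<in> A \<Longrightarrow> j \<in> {1, 2} \<Longrightarrow> v j < K" "\<And>j. j \<in> A \<Longrightarrow> j \<in> {3, 4} \<Longrightarrow> K < v j"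
      "\<And>j. j \<in> A \<Longrightarrow> j \<in> {1, 3} \<Longrightarrow> ftilde_deriv g a J K (v j) < 0"
      "\<And>j. j \<in> A \<Longrightarrow> j \<in> {2, 4} \<Longrightarrow> ftilde_deriv g a J K (v j) > 0"
      using generic_roots[OF assms par nondeg] by blast
    have "card (froots g a J K) = card A"
      unfolding A(2) by (intro card_image strict_mono_on_imp_inj_on A(3))
    then have "card (froots g a J K) \<in> {2, 4}" using A(1) by auto
    moreover have "?labelled P a J K"
      if P: "admissible P" "gexp P = g" "pcoef P = a" "Jpar P = J" "Kpar P = K" for P
    proof -
      define w where "w j = Ilong P / mu0 P * ((1 - v j) / (v j - K)) * Bleft P" for j
      define B where "B j = (1 - K) / (v j - K) * Bleft P" for j
      have root: "v j \<in> froots g a J K" if "j \<in> A" for j using A(2) that by blast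
      then have vK: "v j > 0" "v j \<noteq> K" if "j \<in> A" for j
        using that by (auto simp: froots_def)
      have rc: "rest_coords P (v j) (v j - 1) (w j) (B j)" if "j \<in> A" for j
        using vK(2)[OF that] unfolding P(5)[symmetric]
        by (subst rest_coords_iff[OF P(1)]) (simp_all add: w_def B_def P(5))
      note type = rest_point_type[OF P(1) _ rc, unfolded P(2-5), OF root]
      have entropy: "rel_entropy P (v j) (w j) < rel_entropy P (v i) (w i)"
        if ij: "i \<in> A" "j \<in> A" "i < j" for i j
      proof -
        have "v i < v j" using A(3) ij by (auto dest: strict_mono_onD)
        moreover have "rel_entropy P (v k) (w k) = rest_entropy g a J K (v k)" if "k \<in> A" for k
          using rel_entropy_rest_point[OF P(1) _ vK(1) rc[OF that]] vK that P by simp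
        ultimately show ?thesis
          using rest_entropy_decreasing[OF assms par root[OF ij(1)] root[OF ij(2)]] ij by simp
      qed
      show ?thesis
      proof (rule bexI[OF _ A(1)], rule exI[of _ v], rule exI[of _ "\<lambda>j. v j - 1"],
          rule exI[of _ w], rule exI[of _ B], intro conjI ballI impI)
        show "attractor (tw_field P) (vector [v 1, w 1])" if "1 \<in> A"
          by (rule type(1)) (use that A in auto)
        show "saddle (tw_field P) (vector [v 2, w 2])" if "2 \<in> A"
          by (rule type(2)) (use that A in auto)
        show "saddle (tw_field P) (vector [v 3, w 3])" if "3 \<in> A"
          by (rule type(3)) (use that A in auto)
        show "repellor (tw_field P) (vector [v 4, w 4])" if "4 \<in> A"
          by (rule type(4)) (use that A in auto)
        show "froots g a J K = v ` A" by (rule A(2))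
        show "strict_mono_on A v" by (rule A(3))
        show "rest_coords P (v j) (v j - 1) (w j) (B j)" if "j \<in> A" for j using that by (rule rc)
        show "v j < K" if "j \<in> A" "j \<in> {1, 2}" for j using that by (rule A(4))
        show "K < v j" if "j \<in> A" "j \<in> {3, 4}" for j using that by (rule A(5))
        show "rel_entropy P (v j) (w j) < rel_entropy P (v i) (w i)"
          if "i \<in> A" "j \<in> A" "i < j" for i j using that by (rule entropy)
      qed
    qed
    ultimately show ?thesis by (intro conjI allI impI; (elim conjE)?)
  qed
  show "AE (a, J, K) in (lborel :: (real \<times> real \<times> real) measure).
      a > 0 \<and> J > 0 \<and> 0 \<le> K \<and> K \<noteq> 1 \<longrightarrow> ?generic a J K"
  proof (rule eventually_mono[OF AE_nondegenerate[OF assms]])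
    fix x :: "real \<times> real \<times> real"
    obtain a J K where x: "x = (a, J, K)" by (cases x) auto
    assume "case x of (a, J, K) \<Rightarrow> 0 \<le> K \<and> K \<noteq> 1 \<longrightarrow> nondegenerate g a J K"
    then have nondeg: "0 \<le> K \<Longrightarrow> K \<noteq> 1 \<Longrightarrow> nondegenerate g a J K" by (simp add: x)
    have "a > 0 \<and> J > 0 \<and> 0 \<le> K \<and> K \<noteq> 1 \<longrightarrow> ?generic a J K"
      by (intro impI, elim conjE, rule generic) (assumption | rule nondeg)+
    then show "case x of (a, J, K) \<Rightarrow> a > 0 \<and> J > 0 \<and> 0 \<le> K \<and> K \<noteq> 1 \<longrightarrow> ?generic a J K"
      unfolding x prod.case .
  qed
qed

end
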